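(* Let $P\subset\mathbb{R}^d$ be an anti-blocking lattice polytope with a regular and unimodular triangulation $\mathcal{T}$, and let $\underline{x^{R_i}}-x^{S_i}$, $i=1,\dots,m$, be the reduced Gröbner basis of the toric ideal $I_P$ associated to $\mathcal{T}$. Then a Gröbner basis of the toric ideal $I_{\mathcal{U}P}$ (with respect to the term order induced by the triangulation $\{\sigma S:S\in\mathcal{T},\sigma\in\{-1,+1\}^d\}$ of $\mathcal{U}P$) is given by the binomials \[ \underline{x^{\sigma R_i}} - x^{\sigma S_i}, \qquad i=1,\dots,m,\ \sigma\in\{-1,+1\}^d, \] together with the binomials \[ \underline{x^{\mathbf{p}}\,x^{\mathbf{q}}} - x^{\sigma\mathbf{e}^{(1)}}\,x^{\sigma\mathbf{e}^{(2)}} \] for all separable $\mathbf{p},\mathbf{q}\in\mathcal{U}P\cap\mathbb{Z}^d$ and $\sigma\in\{-1,+1\}^d$ such that $\sigma(\mathbf{p}+\mathbf{q})=\mathbf{e}\in 2P$.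
   Context: A polytope $P\subset\mathbb{R}^d_+$ is anti-blocking if $\mathbf{q}\in P$ and $0\le p_i\le q_i$ for all $i$ imply $\mathbf{p}\in P$; $\mathcal{U}P=\{\mathbf{p}:(|p_1|,\dots,|p_d|)\in P\}$; $\sigma\mathbf{p}=(\sigma_1p_1,\dots,\sigma_dp_d)$ and $\sigma R$ applies this to each element of a multiset $R$. For a lattice polytope $Q$ with $Z=Q\cap\mathbb{Z}^d$, the toric ideal $I_Q\subset\mathbb{C}[x_{\mathbf{p}}:\mathbf{p}\in Z]$ is generated by binomials $x^R-x^S$ where $R,S$ are multisets of points of $Z$ of equal size with equal sums, $x^R=\prod_{\mathbf{r}\in R}x_{\mathbf{r}}$. A regular unimodular triangulation of $Q$ (with vertices in $Z$) induces via its heights a term order; the associated reduced Gröbner basis consists of binomials $\underline{x^R}-x^S$ (leading term underlined) where $R$ ranges over the minimal non-faces of the triangulation and $S$ is the multiset with $\sum R=\sum S$ whose convex hull is a face of a simplex of the triangulation. Given the unimodular triangulation $\mathcal{T}$ of $P$, every lattice point $\mathbf{e}\in 2P$ can be written uniquely as $\mathbf{e}=\mathbf{e}^{(1)}+\mathbf{e}^{(2)}$ with $\mathbf{e}^{(1)},\mathbf{e}^{(2)}\in P\cap\mathbb{Z}^d$ (not necessarily distinct) such that $\mathrm{conv}(\mathbf{e}^{(1)},\mathbf{e}^{(2)})$ is a face of a simplex of $\mathcal{T}$. Two points $\mathbf{p},\mathbf{q}\in\mathbb{R}^d$ are separable if $p_i$ and $q_i$ have different (strict) signs for some $i$. *)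

theory Defs
  imports "HOL-Analysis.Analysis" "HOL-Library.Poly_Mapping" "HOL-Library.Multiset"
begin

section \<open>Polytopes\<close>

definition lattice_points :: "(real^'d) set" where
  "lattice_points = {x. \<forall>i. x $ i \<in> \<int>}"

definition lattice_polytope :: "(real^'d) set \<Rightarrow> bool" where
  "lattice_polytope P \<longleftrightarrow> (\<exists>V. finite V \<and> V \<subseteq> lattice_points \<and> P = convex hull V)"

definition anti_blocking :: "(real^'d) set \<Rightarrow> bool" where
  "anti_blocking P \<longleftrightarrow>
     (\<forall>x\<in>P. \<forall>i. 0 \<le> x $ i) \<and>
     (\<forall>q\<in>P. \<forall>p. (\<forall>i. 0 \<le> p $ i \<and> p $ i \<le> q $ i) \<longrightarrow> p \<in> P)"

definition unconditional :: "(real^'d) set \<Rightarrow> (real^'d) set" where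
  "unconditional P = {p. (\<chi> i. \<bar>p $ i\<bar>) \<in> P}"

text \<open>The action of \<open>\<sigma>\<close> on a point \<open>p\<close> is the componentwise product \<open>\<sigma> * p\<close> of \<open>real^'d\<close>.\<close>

definition sign_vectors :: "(real^'d) set" where
  "sign_vectors = {\<sigma>. \<forall>i. \<sigma> $ i \<in> {-1, 1}}"

definition separable :: "real^'d \<Rightarrow> real^'d \<Rightarrow> bool" where
  "separable p q \<longleftrightarrow> (\<exists>i. p $ i < 0 \<and> 0 < q $ i \<or> 0 < p $ i \<and> q $ i < 0)"

section \<open>Regular unimodular triangulations\<close>

text \<open>
  A triangulation may list only its maximal simplices or be closed under taking faces (and then
  contain the empty face); everything below depends only on the faces of its members.
\<close>

definition vertices :: "(real^'d) set \<Rightarrow> (real^'d) set" where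
  "vertices S = {v. v extreme_point_of S}"

text \<open>
  The edge vectors at a vertex are a basis of the lattice parallel to the affine hull; their
  linear independence is part of being a simplex. This also covers simplices that are not
  full-dimensional.
\<close>

definition unimodular_simplex :: "(real^'d) set \<Rightarrow> bool" where
  "unimodular_simplex S \<longleftrightarrow>
     (\<exists>n. n simplex S) \<and> vertices S \<subseteq> lattice_points \<and>
     (\<forall>v\<^sub>0\<in>vertices S. \<forall>x\<in>lattice_points \<inter> affine hull S.
        \<exists>c :: real^'d \<Rightarrow> int. x - v\<^sub>0 = (\<Sum>v\<in>vertices S - {v\<^sub>0}. of_int (c v) *\<^sub>R (v - v\<^sub>0)))"

definition unimodular_triangulation :: "(real^'d) set \<Rightarrow> (real^'d) set set \<Rightarrow> bool" where
  "unimodular_triangulation Q \<T> \<longleftrightarrow>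
     triangulation \<T> \<and> \<Union>\<T> = Q \<and> (\<forall>S\<in>\<T>. unimodular_simplex S)"

definition lifted_polytope :: "(real^'d) set \<Rightarrow> (real^'d \<Rightarrow> real) \<Rightarrow> ((real^'d) \<times> real) set" where
  "lifted_polytope Q \<omega> = convex hull ((\<lambda>p. (p, \<omega> p)) ` (Q \<inter> lattice_points))"

definition lower_faces :: "((real^'d) \<times> real) set \<Rightarrow> ((real^'d) \<times> real) set set" where
  "lower_faces K = {F. \<exists>a. F = {z\<in>K. \<forall>w\<in>K. (a, 1) \<bullet> z \<le> (a, 1) \<bullet> w}}"

text \<open>
  As \<open>\<T>\<close> covers \<open>Q\<close>, it then contains all maximal cells of the regular subdivision given by \<open>\<omega>\<close>.
\<close>

definition induced_by_heights :: "(real^'d) set \<Rightarrow> (real^'d) set set \<Rightarrow> (real^'d \<Rightarrow> real) \<Rightarrow> bool" where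
  "induced_by_heights Q \<T> \<omega> \<longleftrightarrow>
     triangulation \<T> \<and> \<Union>\<T> = Q \<and>
     (\<forall>S\<in>\<T>. S \<noteq> {} \<longrightarrow> (\<exists>F\<in>lower_faces (lifted_polytope Q \<omega>). S = fst ` F))"

definition regular_triangulation :: "(real^'d) set \<Rightarrow> (real^'d) set set \<Rightarrow> bool" where
  "regular_triangulation Q \<T> \<longleftrightarrow> (\<exists>\<omega>. induced_by_heights Q \<T> \<omega>)"

section \<open>Polynomial rings and Groebner bases\<close>

text \<open>
  A monomial is a multiset of variables, so the polynomials with variables in \<open>'a\<close> are the monoid
  algebra of \<open>'a multiset\<close>, and \<open>\<complex>[x\<^sub>p : p \<in> Z]\<close> is its subring \<open>polys Z\<close>.
\<close>

type_synonym 'a polynomial = "'a multiset \<Rightarrow>\<^sub>0 complex"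

definition monomials :: "'a set \<Rightarrow> 'a multiset set" where
  "monomials Z = {R. set_mset R \<subseteq> Z}"

definition polys :: "'a set \<Rightarrow> 'a polynomial set" where
  "polys Z = {f. Poly_Mapping.keys f \<subseteq> monomials Z}"

definition mon :: "'a multiset \<Rightarrow> 'a polynomial" where
  "mon R = Poly_Mapping.single R 1"

definition ideal_generated :: "'a set \<Rightarrow> 'a polynomial set \<Rightarrow> 'a polynomial set" where
  "ideal_generated Z B =
     {\<Sum>b\<in>F. c b * b | F c. finite F \<and> F \<subseteq> B \<and> (\<forall>b\<in>F. c b \<in> polys Z)}"

definition term_order :: "'a set \<Rightarrow> 'a multiset rel \<Rightarrow> bool" where
  "term_order Z r \<longleftrightarrow>
     linear_order_on (monomials Z) r \<and>
     (\<forall>R\<in>monomials Z. ({#}, R) \<in> r) \<and>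
     (\<forall>R\<in>monomials Z. \<forall>S\<in>monomials Z. \<forall>U\<in>monomials Z. (R, S) \<in> r \<longrightarrow> (R + U, S + U) \<in> r)"

text \<open>The zero polynomial has no leading monomial.\<close>

definition is_leading_monomial :: "'a multiset rel \<Rightarrow> 'a polynomial \<Rightarrow> 'a multiset \<Rightarrow> bool" where
  "is_leading_monomial r f R \<longleftrightarrow>
     R \<in> Poly_Mapping.keys f \<and> (\<forall>S\<in>Poly_Mapping.keys f. (S, R) \<in> r)"

definition leading_ideal :: "'a set \<Rightarrow> 'a multiset rel \<Rightarrow> 'a polynomial set \<Rightarrow> 'a polynomial set" where
  "leading_ideal Z r B = ideal_generated Z {mon R | R f. f \<in> B \<and> is_leading_monomial r f R}"

definition groebner_basis ::
    "'a set \<Rightarrow> 'a multiset rel \<Rightarrow> 'a polynomial set \<Rightarrow> 'a polynomial set \<Rightarrow> bool" where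
  "groebner_basis Z r I G \<longleftrightarrow>
     finite G \<and> G \<subseteq> I \<and> leading_ideal Z r G = leading_ideal Z r I"

definition reduced_groebner_basis ::
    "'a set \<Rightarrow> 'a multiset rel \<Rightarrow> 'a polynomial set \<Rightarrow> 'a polynomial set \<Rightarrow> bool" where
  "reduced_groebner_basis Z r I G \<longleftrightarrow>
     groebner_basis Z r I G \<and>
     (\<forall>g\<in>G. (\<exists>R. is_leading_monomial r g R \<and> Poly_Mapping.lookup g R = 1) \<and>
             (\<forall>R\<in>Poly_Mapping.keys g. mon R \<notin> leading_ideal Z r (G - {g})))"

text \<open>
  A pair \<open>(R, S)\<close> stands for the marked binomial \<open>mon R - mon S\<close>, whose underlined term \<open>mon R\<close>
  has to be the leading term.
\<close>

definition binomials :: "('a multiset \<times> 'a multiset) set \<Rightarrow> 'a polynomial set" where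
  "binomials M = (\<lambda>(R, S). mon R - mon S) ` M"

definition correctly_marked :: "'a multiset rel \<Rightarrow> ('a multiset \<times> 'a multiset) set \<Rightarrow> bool" where
  "correctly_marked r M \<longleftrightarrow> (\<forall>(R, S)\<in>M. is_leading_monomial r (mon R - mon S) R)"

section \<open>Toric ideals\<close>

definition toric_ideal :: "(real^'d) set \<Rightarrow> (real^'d) polynomial set" where
  "toric_ideal Q = ideal_generated (Q \<inter> lattice_points)
     {mon R - mon S | R S. R \<in> monomials (Q \<inter> lattice_points) \<and> S \<in> monomials (Q \<inter> lattice_points) \<and>
        size R = size S \<and> sum_mset R = sum_mset S}"

text \<open>
  A term order induced by \<open>\<T>\<close> refines the weights given by heights inducing \<open>\<T>\<close>. Toric ideals of
  polytopes are homogeneous, hence only monomials of equal degree need to be compared; this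
  allows heights of arbitrary sign, which could otherwise contradict \<open>1\<close> being the least monomial.
  Ties are broken arbitrarily.
\<close>

definition induced_term_order :: "(real^'d) set \<Rightarrow> (real^'d) set set \<Rightarrow> (real^'d) multiset rel \<Rightarrow> bool" where
  "induced_term_order Q \<T> r \<longleftrightarrow>
     term_order (Q \<inter> lattice_points) r \<and>
     (\<exists>\<omega>. induced_by_heights Q \<T> \<omega> \<and>
        (\<forall>R\<in>monomials (Q \<inter> lattice_points). \<forall>S\<in>monomials (Q \<inter> lattice_points).
           size R = size S \<and> (\<Sum>p\<in>#R. \<omega> p) < (\<Sum>p\<in>#S. \<omega> p) \<longrightarrow> (R, S) \<in> r))"

section \<open>The unconditional triangulation and its binomials\<close>

definition signed_triangulation :: "(real^'d) set set \<Rightarrow> (real^'d) set set" where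
  "signed_triangulation \<T> = {(*) \<sigma> ` S | \<sigma> S. \<sigma> \<in> sign_vectors \<and> S \<in> \<T>}"

definition signed_binomials ::
    "((real^'d) multiset \<times> (real^'d) multiset) set \<Rightarrow> ((real^'d) multiset \<times> (real^'d) multiset) set" where
  "signed_binomials M =
     {(image_mset ((*) \<sigma>) R, image_mset ((*) \<sigma>) S) | \<sigma> R S. \<sigma> \<in> sign_vectors \<and> (R, S) \<in> M}"

text \<open>\<open>e = e\<^sub>1 + e\<^sub>2\<close> is the decomposition of \<open>e \<in> 2P\<close>, which is unique up to swapping \<open>e\<^sub>1\<close> and \<open>e\<^sub>2\<close>.\<close>

definition edge_decomposition ::
    "(real^'d) set \<Rightarrow> (real^'d) set set \<Rightarrow> real^'d \<Rightarrow> real^'d \<Rightarrow> real^'d \<Rightarrow> bool" where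
  "edge_decomposition P \<T> e e\<^sub>1 e\<^sub>2 \<longleftrightarrow>
     e\<^sub>1 \<in> P \<inter> lattice_points \<and> e\<^sub>2 \<in> P \<inter> lattice_points \<and> e = e\<^sub>1 + e\<^sub>2 \<and>
     (\<exists>S\<in>\<T>. convex hull {e\<^sub>1, e\<^sub>2} face_of S)"

definition separable_binomials ::
    "(real^'d) set \<Rightarrow> (real^'d) set set \<Rightarrow> ((real^'d) multiset \<times> (real^'d) multiset) set" where
  "separable_binomials P \<T> =
     {({#p, q#}, {#\<sigma> * e\<^sub>1, \<sigma> * e\<^sub>2#}) | p q \<sigma> e e\<^sub>1 e\<^sub>2.
        p \<in> unconditional P \<inter> lattice_points \<and> q \<in> unconditional P \<inter> lattice_points \<and> separable p q \<and>
        \<sigma> \<in> sign_vectors \<and> \<sigma> * (p + q) = e \<and> e \<in> (*\<^sub>R) 2 ` P \<and>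
        edge_decomposition P \<T> e e\<^sub>1 e\<^sub>2}"

end

theory Submission
  imports Defs
begin

text \<open>
  Call a monomial a face monomial if its support lies in one cell. If \<open>\<omega>\<close> are heights inducing a
  unimodular triangulation, every cell has an affine function supporting \<open>\<omega>\<close> exactly on it, so a
  face monomial is the unique monomial of least weight among those with the same degree and the same
  sum. Coefficients of an element of the toric ideal add up to zero over each such fiber; hence face
  monomials are never leading monomials, and it suffices that every non-face monomial of the
  unconditional polytope is divisible by a marked one. If it contains a separable pair, this is the
  pair itself; otherwise it lies in one orthant, where the Groebner basis of \<open>P\<close> applies after a sign
  change. Reducedness is what makes the trailing monomials \<open>S i\<close> face monomials, so that the marking
  survives for every term order induced by the signed triangulation.
\<close>

section \<open>Ideals and leading monomials\<close>

text \<open>The orders on the two sides are linked only through the triangulation: \<open>r'\<close>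
  may use any heights that induce the signed triangulation, and these need not be related to the
  heights behind \<open>r\<close>. What passes from \<open>P\<close> to the unconditional polytope
  must therefore be free of any order: that each non-face monomial is divisible by a marked one, and
  that trailing terms are face monomials in the fiber of the marked term. The order
  \<open>r'\<close> enters only at the end, where minimality of face monomials turns both facts into
  statements about leading terms. Fibers are tied to the geometry by averaging: a monomial of degree
  \<open>n\<close> and sum \<open>s\<close> sits over the point \<open>s / n\<close>, and the cell
  through that point, being unimodular, supplies the face monomial of the fiber. Anti-blocking is
  what makes separable pairs reducible: the coordinates of \<open>p\<close> and \<open>q\<close>
  with opposite signs cancel in \<open>p + q\<close>, so half of the sum, reflected into the
  positive orthant, stays in \<open>P\<close>.\<close>

lemma keys_mon [simp]: "Poly_Mapping.keys (mon R) = {R}"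
  by (simp add: mon_def)

lemma mon_mult_mon: "mon R * mon S = mon (R + S)"
  by (simp add: mon_def mult_single)

lemma keys_mon_diff_mon: "R \<noteq> S \<Longrightarrow> Poly_Mapping.keys (mon R - mon S) = {R, S}"
  by (auto simp: mon_def in_keys_iff lookup_minus lookup_single when_def split: if_splits)

lemma monomials_add: "R \<in> monomials Z \<Longrightarrow> S \<in> monomials Z \<Longrightarrow> R + S \<in> monomials Z"
  by (auto simp: monomials_def)

lemma monomials_subset_mset: "R \<in> monomials Z \<Longrightarrow> S \<subseteq># R \<Longrightarrow> S \<in> monomials Z"
  by (auto simp: monomials_def dest: set_mset_mono)

lemma polys_0: "0 \<in> polys Z"
  by (simp add: polys_def)

lemma polys_1: "1 \<in> polys Z"
  by (simp add: polys_def monomials_def)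

lemma polys_mon: "R \<in> monomials Z \<Longrightarrow> mon R \<in> polys Z"
  by (simp add: polys_def)

lemma polys_add: "f \<in> polys Z \<Longrightarrow> g \<in> polys Z \<Longrightarrow> f + g \<in> polys Z"
  using keys_add[of f g] by (auto simp: polys_def)

lemma polys_mult: "f \<in> polys Z \<Longrightarrow> g \<in> polys Z \<Longrightarrow> f * g \<in> polys Z"
  using keys_mult[of f g] by (fastforce simp: polys_def intro: monomials_add)

lemma ideal_generated_multiple:
  assumes "b \<in> B" "c \<in> polys Z"
  shows "c * b \<in> ideal_generated Z B"
proof -
  have "c * b = (\<Sum>b\<in>{b}. c * b)" by simp
  then show ?thesis
    using assms unfolding ideal_generated_def by (intro CollectI exI[of _ "{b}"] exI[of _ "\<lambda>_. c"]) auto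
qed

lemma ideal_generated_base: "b \<in> B \<Longrightarrow> b \<in> ideal_generated Z B"
  using ideal_generated_multiple[of b B 1 Z] by (simp add: polys_1)

lemma ideal_generated_0: "0 \<in> ideal_generated Z B"
  unfolding ideal_generated_def by (intro CollectI exI[of _ "{}"]) auto

lemma ideal_generated_add:
  assumes "f \<in> ideal_generated Z B" "g \<in> ideal_generated Z B"
  shows "f + g \<in> ideal_generated Z B"
proof -
  obtain F c where F: "f = (\<Sum>b\<in>F. c b * b)" "finite F" "F \<subseteq> B" "\<forall>b\<in>F. c b \<in> polys Z"
    using assms(1) unfolding ideal_generated_def by blast
  obtain G d where G: "g = (\<Sum>b\<in>G. d b * b)" "finite G" "G \<subseteq> B" "\<forall>b\<in>G. d b \<in> polys Z"
    using assms(2) unfolding ideal_generated_def by blast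
  \<comment> \<open>The two combinations may share generators, so their coefficients are added on
    the union, with default value 0 outside the own index set.\<close>
  define e where "e b = (if b \<in> F then c b else 0) + (if b \<in> G then d b else 0)" for b
  have "f = (\<Sum>b\<in>F \<union> G. (if b \<in> F then c b else 0) * b)"
    unfolding F(1) using F(2) G(2) by (intro sum.mono_neutral_cong_left) auto
  moreover have "g = (\<Sum>b\<in>F \<union> G. (if b \<in> G then d b else 0) * b)"
    unfolding G(1) using F(2) G(2) by (intro sum.mono_neutral_cong_left) auto
  ultimately have "f + g = (\<Sum>b\<in>F \<union> G. e b * b)"
    by (simp add: e_def distrib_right sum.distrib)
  moreover have "\<forall>b\<in>F \<union> G. e b \<in> polys Z"
    using F(4) G(4) by (auto simp: e_def intro!: polys_add polys_0)
  ultimately show ?thesis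
    using F(2,3) G(2,3) unfolding ideal_generated_def
    by (intro CollectI exI[of _ "F \<union> G"] exI[of _ e]) auto
qed

lemma ideal_generated_mult:
  assumes "f \<in> ideal_generated Z B" "p \<in> polys Z"
  shows "p * f \<in> ideal_generated Z B"
proof -
  obtain F c where F: "f = (\<Sum>b\<in>F. c b * b)" "finite F" "F \<subseteq> B" "\<forall>b\<in>F. c b \<in> polys Z"
    using assms(1) unfolding ideal_generated_def by blast
  have "p * f = (\<Sum>b\<in>F. (p * c b) * b)"
    by (simp add: F(1) sum_distrib_left mult.assoc)
  moreover have "\<forall>b\<in>F. p * c b \<in> polys Z"
    using F(4) assms(2) by (blast intro: polys_mult)
  ultimately show ?thesis
    using F(2,3) unfolding ideal_generated_def
    by (intro CollectI exI[of _ F] exI[of _ "\<lambda>b. p * c b"]) auto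
qed

lemma ideal_generated_least:
  assumes "B \<subseteq> ideal_generated Z C"
  shows "ideal_generated Z B \<subseteq> ideal_generated Z C"
proof
  fix f assume "f \<in> ideal_generated Z B"
  then obtain F c where F: "f = (\<Sum>b\<in>F. c b * b)" "finite F" "F \<subseteq> B" "\<forall>b\<in>F. c b \<in> polys Z"
    unfolding ideal_generated_def by blast
  have "(\<Sum>b\<in>F. c b * b) \<in> ideal_generated Z C"
    using F(2-4)
  proof (induction F rule: finite_induct)
    case empty
    show ?case by (simp add: ideal_generated_0)
  next
    case (insert b F)
    then show ?case
      using assms by (auto intro!: ideal_generated_add ideal_generated_mult)
  qed
  then show "f \<in> ideal_generated Z C" by (simp add: F(1))
qed

text \<open>A sum has no monomials beyond those of its summands: \<open>R\<close> occurs in some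
  \<open>c b * b\<close>, and since \<open>b\<close> is itself a monomial, every key of that product
  is a multiple of it.\<close>

lemma leading_ideal_mon_dvd:
  assumes "mon R \<in> leading_ideal Z r B"
  obtains f A where "f \<in> B" "is_leading_monomial r f A" "A \<subseteq># R"
proof -
  obtain F c where F: "mon R = (\<Sum>b\<in>F. c b * b)"
      "F \<subseteq> {mon R | R f. f \<in> B \<and> is_leading_monomial r f R}"
    using assms unfolding leading_ideal_def ideal_generated_def by blast
  have "R \<in> Poly_Mapping.keys (\<Sum>b\<in>F. c b * b)"
    unfolding F(1)[symmetric] by simp
  then obtain b where b: "b \<in> F" "R \<in> Poly_Mapping.keys (c b * b)"
    using keys_sum[of "\<lambda>b. c b * b" F] by blast
  obtain f A where A: "b = mon A" "f \<in> B" "is_leading_monomial r f A"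
    using F(2) b(1) by blast
  have "A \<subseteq># R"
    using b(2) keys_mult[of "c b" b] by (auto simp: A(1))
  with A that show thesis by blast
qed

lemma mon_in_leading_ideal:
  assumes "f \<in> B" "is_leading_monomial r f A" "A \<subseteq># R" "R \<in> monomials Z"
  shows "mon R \<in> leading_ideal Z r B"
proof -
  have "mon R = mon (R - A) * mon A"
    using assms(3) by (simp add: mon_mult_mon subset_mset.diff_add)
  moreover have "R - A \<in> monomials Z"
    using assms(4) by (rule monomials_subset_mset) (rule diff_subset_eq_self)
  ultimately show ?thesis
    using assms(1,2) unfolding leading_ideal_def
    by (auto intro!: ideal_generated_multiple polys_mon)
qed

lemma is_leading_monomial_unique:
  assumes "term_order Z r" "is_leading_monomial r f A" "is_leading_monomial r f B"
  shows "A = B"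
  using assms unfolding term_order_def is_leading_monomial_def order_on_defs antisym_def by blast

lemma is_leading_monomial_in_monomials:
  assumes "term_order Z r" "is_leading_monomial r f A" "B \<in> Poly_Mapping.keys f"
  shows "B \<in> monomials Z"
  using assms unfolding term_order_def is_leading_monomial_def order_on_defs by blast

lemma is_leading_monomial_binomial:
  assumes "term_order Z r" "R \<in> monomials Z" "R \<noteq> S" "(S, R) \<in> r"
  shows "is_leading_monomial r (mon R - mon S) R"
  using assms unfolding is_leading_monomial_def term_order_def order_on_defs refl_on_def
  by (auto simp: keys_mon_diff_mon)

lemma groebner_basisI:
  assumes "term_order Z r" "finite G" "G \<subseteq> I"
    and lead: "\<And>f R. f \<in> I \<Longrightarrow> is_leading_monomial r f R \<Longrightarrow>
      \<exists>g\<in>G. \<exists>A. is_leading_monomial r g A \<and> A \<subseteq># R"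
  shows "groebner_basis Z r I G"
proof -
  have "leading_ideal Z r G \<subseteq> leading_ideal Z r I"
    unfolding leading_ideal_def using assms(3)
    by (intro ideal_generated_least subsetI ideal_generated_base) auto
  moreover have "mon R \<in> leading_ideal Z r G" if "f \<in> I" "is_leading_monomial r f R" for f R
  proof -
    have "R \<in> monomials Z"
      using is_leading_monomial_in_monomials[OF assms(1) that(2)] that(2)
      by (simp add: is_leading_monomial_def)
    then show ?thesis
      using lead[OF that] mon_in_leading_ideal by blast
  qed
  then have "leading_ideal Z r I \<subseteq> leading_ideal Z r G"
    unfolding leading_ideal_def[of Z r I] unfolding leading_ideal_def[of Z r G]
    by (intro ideal_generated_least) (auto simp: leading_ideal_def)
  ultimately show ?thesis
    using assms(2,3) by (simp add: groebner_basis_def)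
qed

section \<open>Fibers of toric ideals\<close>

definition same_fiber :: "'a::comm_monoid_add multiset \<Rightarrow> 'a multiset \<Rightarrow> bool" where
  "same_fiber R S \<longleftrightarrow> size R = size S \<and> sum_mset R = sum_mset S"

text \<open>Mapping each monomial to its degree and sum extends to a ring homomorphism; this is the
  coefficient of the image of \<open>f\<close> at the degree and sum of \<open>A\<close>. The toric
  ideal lies in the kernel, so all these numbers vanish on it.\<close>

definition fiber_sum :: "'a::comm_monoid_add multiset \<Rightarrow> 'a polynomial \<Rightarrow> complex" where
  "fiber_sum A f = (\<Sum>R\<in>Poly_Mapping.keys f. if same_fiber A R then Poly_Mapping.lookup f R else 0)"

lemma fiber_sum_superset:
  assumes "finite K" "Poly_Mapping.keys f \<subseteq> K"
  shows "fiber_sum A f = (\<Sum>R\<in>K. if same_fiber A R then Poly_Mapping.lookup f R else 0)"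
  unfolding fiber_sum_def using assms
  by (intro sum.mono_neutral_left) (auto simp: in_keys_iff)

lemma fiber_sum_add: "fiber_sum A (f + g) = fiber_sum A f + fiber_sum A g"
proof -
  let ?K = "Poly_Mapping.keys f \<union> Poly_Mapping.keys g"
  have "fiber_sum A h = (\<Sum>R\<in>?K. if same_fiber A R then Poly_Mapping.lookup h R else 0)"
    if "h \<in> {f, g, f + g}" for h
    using that keys_add[of f g] by (intro fiber_sum_superset) auto
  then show ?thesis
    by (auto simp: sum.distrib[symmetric] lookup_add intro!: sum.cong)
qed

lemma fiber_sum_uminus: "fiber_sum A (- f) = - fiber_sum A f"
  by (auto simp: fiber_sum_def sum_negf[symmetric] intro!: sum.cong)

lemma fiber_sum_diff: "fiber_sum A (f - g) = fiber_sum A f - fiber_sum A g"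
  using fiber_sum_add[of A f "- g"] by (simp add: fiber_sum_uminus)

lemma fiber_sum_sum: "fiber_sum A (sum f I) = (\<Sum>i\<in>I. fiber_sum A (f i))"
  by (induction I rule: infinite_finite_induct)
    (simp_all add: fiber_sum_add, simp_all add: fiber_sum_def)

lemma fiber_sum_single:
  "fiber_sum A (Poly_Mapping.single R c) = (if same_fiber A R then c else 0)"
  by (simp add: fiber_sum_def)

lemma poly_mapping_sum_single:
  "(\<Sum>R\<in>Poly_Mapping.keys f. Poly_Mapping.single R (Poly_Mapping.lookup f R)) = f"
  by (rule poly_mapping_eqI) (auto simp: lookup_sum lookup_single when_def in_keys_iff)

text \<open>Multiplication by a monomial moves fibers as a whole: \<open>U + R\<close> and
  \<open>U + S\<close> share a fiber whenever \<open>R\<close> and \<open>S\<close> do, so the two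
  halves of the product contribute equally.\<close>

lemma fiber_sum_mult_binomial:
  assumes "same_fiber R S"
  shows "fiber_sum A (c * (mon R - mon S)) = 0"
proof -
  have "fiber_sum A (c * mon R) = fiber_sum A (c * mon S)"
  proof -
    have "fiber_sum A (c * mon T) = (\<Sum>U\<in>Poly_Mapping.keys c.
        if same_fiber A (U + T) then Poly_Mapping.lookup c U else 0)" for T
      by (subst poly_mapping_sum_single[of c, symmetric])
        (simp add: sum_distrib_right fiber_sum_sum mon_def mult_single fiber_sum_single)
    moreover have "same_fiber A (U + R) \<longleftrightarrow> same_fiber A (U + S)" for U
      using assms by (auto simp: same_fiber_def)
    ultimately show ?thesis by simp
  qed
  then show ?thesis by (simp add: right_diff_distrib fiber_sum_diff)
qed

lemma fiber_sum_toric_ideal: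
  assumes "f \<in> toric_ideal Q"
  shows "fiber_sum A f = 0"
proof -
  obtain F c where "f = (\<Sum>b\<in>F. c b * b)"
    and F: "F \<subseteq> {mon R - mon S | R S. R \<in> monomials (Q \<inter> lattice_points) \<and>
        S \<in> monomials (Q \<inter> lattice_points) \<and> size R = size S \<and> sum_mset R = sum_mset S}"
    using assms unfolding toric_ideal_def ideal_generated_def by blast
  moreover have "fiber_sum A (c b * b) = 0" if "b \<in> F" for b
  proof -
    obtain R S where "b = mon R - mon S" "same_fiber R S"
      using F \<open>b \<in> F\<close> unfolding same_fiber_def by blast
    then show ?thesis by (simp add: fiber_sum_mult_binomial)
  qed
  ultimately show ?thesis by (simp add: fiber_sum_sum)
qed

text \<open>A key alone in its fiber would make the fiber sum equal to its own nonzero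
  coefficient.\<close>

lemma toric_ideal_fiber_partner:
  assumes "f \<in> toric_ideal Q" "R \<in> Poly_Mapping.keys f"
  obtains S where "S \<in> Poly_Mapping.keys f" "S \<noteq> R" "same_fiber R S"
proof (rule ccontr)
  assume "\<not> thesis"
  then have "fiber_sum R f = (\<Sum>S\<in>{R}. Poly_Mapping.lookup f S)"
    unfolding fiber_sum_def using assms(2) that
    by (intro sum.mono_neutral_cong_right) (auto simp: same_fiber_def)
  then show False
    using fiber_sum_toric_ideal[OF assms(1), of R] assms(2) by (simp add: in_keys_iff)
qed

text \<open>The partner of \<open>R\<close> in its fiber can only be \<open>S\<close>. This recovers
  degree and sum for basis elements that are merely known to be binomials in the ideal.\<close>

lemma binomial_toric_ideal_same_fiber:
  assumes "mon R - mon S \<in> toric_ideal Q"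
  shows "same_fiber R S"
proof (cases "R = S")
  case False
  then show ?thesis
    using toric_ideal_fiber_partner[OF assms, of R] by (auto simp: keys_mon_diff_mon)
qed (simp add: same_fiber_def)

lemma binomial_in_toric_ideal:
  assumes "R \<in> monomials (Q \<inter> lattice_points)" "S \<in> monomials (Q \<inter> lattice_points)" "same_fiber R S"
  shows "mon R - mon S \<in> toric_ideal Q"
  using assms unfolding toric_ideal_def same_fiber_def by (intro ideal_generated_base) blast

section \<open>Unimodular simplices\<close>

lemma finite_lattice_points_bounded:
  fixes Q :: "(real^'d) set"
  assumes "bounded Q"
  shows "finite (Q \<inter> lattice_points)"
proof -
  obtain B where B: "\<And>x. x \<in> Q \<Longrightarrow> norm x \<le> B"
    using assms by (auto simp: bounded_iff)
  let ?N = "{-\<lceil>B\<rceil>..\<lceil>B\<rceil>}"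
  have "x \<in> (\<lambda>f. \<chi> i. real_of_int (f i)) ` (UNIV \<rightarrow>\<^sub>E ?N)" if "x \<in> Q \<inter> lattice_points" for x :: "real^'d"
  proof -
    have "\<forall>i. \<exists>k::int. x $ i = of_int k"
      using that by (auto simp: lattice_points_def elim: Ints_cases)
    then obtain k :: "'d \<Rightarrow> int" where k: "\<And>i. x $ i = of_int (k i)" by metis
    have "k i \<in> ?N" for i
    proof -
      have "\<bar>real_of_int (k i)\<bar> \<le> B"
        using component_le_norm_cart[of x i] B[of x] that by (simp add: k)
      then show ?thesis by (auto simp: abs_le_iff) linarith+
    qed
    then have "k \<in> UNIV \<rightarrow>\<^sub>E ?N" by (simp add: PiE_iff)
    moreover have "x = (\<chi> i. real_of_int (k i))" by (simp add: vec_eq_iff k)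
    ultimately show ?thesis by blast
  qed
  then have "Q \<inter> lattice_points \<subseteq> (\<lambda>f. \<chi> i. real_of_int (f i)) ` (UNIV \<rightarrow>\<^sub>E ?N)" by blast
  then show ?thesis
    by (rule finite_subset) (intro finite_imageI finite_PiE; simp)
qed

lemma lattice_points_add: "x \<in> lattice_points \<Longrightarrow> y \<in> lattice_points \<Longrightarrow> x + y \<in> lattice_points"
  by (simp add: lattice_points_def)

lemma lattice_points_diff: "x \<in> lattice_points \<Longrightarrow> y \<in> lattice_points \<Longrightarrow> x - y \<in> lattice_points"
  by (simp add: lattice_points_def)

lemma lattice_points_scaleR_nat: "x \<in> lattice_points \<Longrightarrow> real n *\<^sub>R x \<in> lattice_points"
  by (simp add: lattice_points_def)

lemma lattice_points_sum_mset: "set_mset R \<subseteq> lattice_points \<Longrightarrow> sum_mset R \<in> lattice_points"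
  by (induction R) (auto simp: lattice_points_def)

lemma simplex_vertices:
  assumes "n simplex S"
  shows "finite (vertices S)" "\<not> affine_dependent (vertices S)" "S = convex hull vertices S"
proof -
  obtain C where C: "\<not> affine_dependent C" "S = convex hull C"
    using assms by (auto simp: simplex_def)
  have "vertices S = C"
    using C by (auto simp: vertices_def extreme_point_of_convex_hull_affine_independent)
  then show "finite (vertices S)" "\<not> affine_dependent (vertices S)" "S = convex hull vertices S"
    using C aff_independent_finite by auto
qed

lemma unimodular_simplex_vertices:
  assumes "unimodular_simplex S"
  shows "finite (vertices S)" "\<not> affine_dependent (vertices S)" "S = convex hull vertices S"
    "vertices S \<subseteq> S \<inter> lattice_points"
proof -
  obtain n where n: "n simplex S" using assms by (auto simp: unimodular_simplex_def)
  show "finite (vertices S)" "\<not> affine_dependent (vertices S)" and hull: "S = convex hull vertices S"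
    using simplex_vertices[OF n] by auto
  show "vertices S \<subseteq> S \<inter> lattice_points"
    using assms hull hull_subset[of "vertices S" convex] by (auto simp: unimodular_simplex_def)
qed

text \<open>The common total is arbitrary instead of 1, because the coefficients to be compared are
  multiplicities of a monomial and add up to its degree.\<close>

lemma affine_independent_coeffs_unique:
  fixes V :: "'a::real_vector set"
  assumes "finite V" "\<not> affine_dependent V" "sum c V = sum d V"
    "(\<Sum>v\<in>V. c v *\<^sub>R v) = (\<Sum>v\<in>V. d v *\<^sub>R v)" "v \<in> V"
  shows "c v = d v"
proof (rule ccontr)
  assume "c v \<noteq> d v"
  then have "affine_dependent V"
    unfolding affine_dependent_explicit_finite[OF assms(1)] using assms(3-5)
    by (intro exI[of _ "\<lambda>v. c v - d v"]) (auto simp: sum_subtractf scaleR_left_diff_distrib)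
  with assms(2) show False by simp
qed

lemma sum_mset_eq_sum_count:
  fixes f :: "'a \<Rightarrow> 'b::real_vector"
  assumes "finite V" "set_mset R \<subseteq> V"
  shows "(\<Sum>v\<in>#R. f v) = (\<Sum>v\<in>V. real (count R v) *\<^sub>R f v)"
  using assms(2)
proof (induction R)
  case (add x R)
  have "(\<Sum>v\<in>V. real (count (add_mset x R) v) *\<^sub>R f v) =
      (\<Sum>v\<in>V. real (count R v) *\<^sub>R f v + (if v = x then f v else 0))"
    by (intro sum.cong) (auto simp: algebra_simps)
  also have "\<dots> = (\<Sum>v\<in>V. real (count R v) *\<^sub>R f v) + f x"
    using add.prems assms(1) by (simp add: sum.distrib)
  finally show ?case using add by (simp add: add.commute)
qed simp

lemma size_eq_sum_count:
  assumes "finite V" "set_mset R \<subseteq> V"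
  shows "real (size R) = (\<Sum>v\<in>V. real (count R v))"
  using sum_mset_eq_sum_count[OF assms, of "\<lambda>_. 1::real"] by simp

text \<open>Unimodularity makes the barycentric coordinates of \<open>x\<close> integral after
  scaling by \<open>n\<close>; being nonnegative as well, they can serve as multiplicities of
  vertices.\<close>

lemma unimodular_simplex_decomposition:
  fixes S :: "(real^'d) set"
  assumes S: "unimodular_simplex S" and x: "x \<in> S" and "0 < n"
    and lat: "real n *\<^sub>R x \<in> lattice_points"
  obtains R where "set_mset R \<subseteq> vertices S" "size R = n" "sum_mset R = real n *\<^sub>R x"
proof -
  define V where "V = vertices S"
  have V: "finite V" "\<not> affine_dependent V" "S = convex hull V" "V \<subseteq> S \<inter> lattice_points"
    using unimodular_simplex_vertices[OF S] by (simp_all add: V_def)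
  obtain l where l: "\<And>v. v \<in> V \<Longrightarrow> 0 \<le> l v" "sum l V = 1" "(\<Sum>v\<in>V. l v *\<^sub>R v) = x"
    using x V(3) convex_hull_finite[OF V(1)] by auto
  obtain v0 where v0: "v0 \<in> V" using l(2) by fastforce
  \<comment> \<open>The multiple of \<open>v0\<close> brings the total coefficient from
    \<open>n\<close> back to 1, so that \<open>y\<close> is in the affine hull of \<open>S\<close>,
    where the lattice basis of edge vectors applies.\<close>
  define y where "y = real n *\<^sub>R x + (1 - real n) *\<^sub>R v0"
  have "y \<in> affine hull S"
    unfolding y_def using x v0 V(4)
    by (intro mem_affine affine_affine_hull) (auto intro: hull_inc)
  moreover have "y = real n *\<^sub>R x - real (n - 1) *\<^sub>R v0"
    using \<open>0 < n\<close> by (simp add: y_def of_nat_diff algebra_simps)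
  then have "y \<in> lattice_points"
    using lat v0 V(4) by (auto intro!: lattice_points_diff lattice_points_scaleR_nat)
  ultimately obtain c :: "real^'d \<Rightarrow> int"
    where c: "y - v0 = (\<Sum>v\<in>V - {v0}. of_int (c v) *\<^sub>R (v - v0))"
    using S v0 unfolding unimodular_simplex_def V_def by blast
  \<comment> \<open>The coefficient at \<open>v0\<close> is chosen so that the total is
    \<open>n\<close>.\<close>
  define d where "d v = (if v = v0 then int n - (\<Sum>v\<in>V - {v0}. c v) else c v)" for v
  have sum_d: "(\<Sum>v\<in>V. real_of_int (d v)) = real n"
  proof -
    have "(\<Sum>v\<in>V. d v) = d v0 + (\<Sum>v\<in>V - {v0}. c v)"
      using V(1) v0 by (simp add: sum.remove d_def)
    then have "(\<Sum>v\<in>V. d v) = int n" by (simp add: d_def)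
    then show ?thesis by (metis of_int_of_nat_eq of_int_sum)
  qed
  have "(\<Sum>v\<in>V. real_of_int (d v) *\<^sub>R v) = real n *\<^sub>R x"
  proof -
    have "(\<Sum>v\<in>V. real_of_int (d v) *\<^sub>R v)
        = real_of_int (d v0) *\<^sub>R v0 + (\<Sum>v\<in>V - {v0}. real_of_int (c v) *\<^sub>R v)"
      using V(1) v0 by (simp add: sum.remove d_def)
    also have "\<dots> = real n *\<^sub>R v0 + (y - v0)"
      by (simp add: c d_def algebra_simps sum_subtractf scaleR_left.sum)
    finally show ?thesis by (simp add: y_def algebra_simps)
  qed
  moreover have "(\<Sum>v\<in>V. (real n * l v) *\<^sub>R v) = real n *\<^sub>R x"
    by (simp add: l(3)[symmetric] scaleR_sum_right)
  moreover have "(\<Sum>v\<in>V. real n * l v) = real n"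
    by (simp add: sum_distrib_left[symmetric] l(2))
  \<comment> \<open>Integer and barycentric coefficients have the same total and the same sum, so
    they agree; the former inherit nonnegativity from the latter.\<close>
  ultimately have "real_of_int (d v) = real n * l v" if "v \<in> V" for v
    using affine_independent_coeffs_unique[OF V(1,2) _ _ that, of "\<lambda>v. real_of_int (d v)" "\<lambda>v. real n * l v"] sum_d
    by simp
  then have "0 \<le> real_of_int (d v)" if "v \<in> V" for v
    using l(1) that by simp
  then have d_nonneg: "0 \<le> d v" if "v \<in> V" for v
    using that by simp
  define R where "R = (\<Sum>v\<in>V. replicate_mset (nat (d v)) v)"
  have count_R: "count R u = (if u \<in> V then nat (d u) else 0)" for u
    using V(1) by (simp add: R_def count_sum)
  have R: "set_mset R \<subseteq> V"
    by (metis count_R count_eq_zero_iff subsetI)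
  have "real (size R) = (\<Sum>v\<in>V. real_of_int (d v))"
    unfolding size_eq_sum_count[OF V(1) R] by (intro sum.cong) (simp_all add: count_R d_nonneg)
  then have "size R = n" by (simp add: sum_d)
  moreover have "sum_mset R = (\<Sum>v\<in>V. real_of_int (d v) *\<^sub>R v)"
    using sum_mset_eq_sum_count[OF V(1) R, of "\<lambda>v. v"] by (simp add: count_R d_nonneg)
  then have "sum_mset R = real n *\<^sub>R x"
    using \<open>(\<Sum>v\<in>V. real_of_int (d v) *\<^sub>R v) = real n *\<^sub>R x\<close> by simp
  ultimately show thesis using R that by (simp add: V_def)
qed

text \<open>The degree one case of the decomposition: a lattice point of \<open>S\<close> is a sum
  of a single vertex.\<close>

lemma unimodular_simplex_lattice_points:
  assumes "unimodular_simplex S"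
  shows "S \<inter> lattice_points = vertices S"
proof
  show "S \<inter> lattice_points \<subseteq> vertices S"
  proof
    fix x assume x: "x \<in> S \<inter> lattice_points"
    obtain R where R: "set_mset R \<subseteq> vertices S" "size R = 1" "sum_mset R = real 1 *\<^sub>R x"
      using x unimodular_simplex_decomposition[OF assms, of x 1] by auto
    then obtain v where "R = {#v#}" by (metis One_nat_def size_1_singleton_mset)
    with R show "x \<in> vertices S" by simp
  qed
qed (use unimodular_simplex_vertices(4)[OF assms] in blast)

text \<open>By the previous lemma both monomials live on the vertices, and there the multiplicities
  are coordinates with respect to an affinely independent family.\<close>

lemma unimodular_simplex_fiber_unique:
  assumes S: "unimodular_simplex S"
    and "set_mset R \<subseteq> S \<inter> lattice_points" "set_mset R' \<subseteq> S \<inter> lattice_points" "same_fiber R R'"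
  shows "R = R'"
proof -
  let ?V = "vertices S"
  have V: "finite ?V" "\<not> affine_dependent ?V" "set_mset R \<subseteq> ?V" "set_mset R' \<subseteq> ?V"
    using assms unimodular_simplex_vertices[OF S] unimodular_simplex_lattice_points[OF S] by auto
  have "count R v = count R' v" for v
  proof (cases "v \<in> ?V")
    case True
    have "(\<Sum>v\<in>?V. real (count R v)) = (\<Sum>v\<in>?V. real (count R' v))"
      using assms(4) size_eq_sum_count[OF V(1,3)] size_eq_sum_count[OF V(1,4)]
      by (simp add: same_fiber_def)
    moreover have "(\<Sum>v\<in>?V. real (count R v) *\<^sub>R v) = (\<Sum>v\<in>?V. real (count R' v) *\<^sub>R v)"
      using assms(4) sum_mset_eq_sum_count[OF V(1,3), of "\<lambda>v. v"]
        sum_mset_eq_sum_count[OF V(1,4), of "\<lambda>v. v"]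
      by (simp add: same_fiber_def)
    ultimately show ?thesis
      using affine_independent_coeffs_unique[OF V(1,2) _ _ True, of "\<lambda>v. real (count R v)" "\<lambda>v. real (count R' v)"]
      by simp
  next
    case False
    then show ?thesis using V(3,4) by (metis count_eq_zero_iff subsetD)
  qed
  then show ?thesis by (rule multiset_eqI)
qed

section \<open>Heights and face monomials\<close>

lemma lower_face_of_lifted_polytope:
  fixes Q :: "(real^'d) set"
  defines "K \<omega> \<equiv> lifted_polytope Q \<omega>"
  assumes fin: "finite (Q \<inter> lattice_points)"
    and F: "F = {z \<in> K \<omega>. \<forall>w\<in>K \<omega>. (a, 1) \<bullet> z \<le> (a, 1) \<bullet> w}"
  obtains B where "B \<subseteq> Q \<inter> lattice_points" "F = convex hull ((\<lambda>p. (p, \<omega> p)) ` B)"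
    "fst ` F = convex hull B"
proof -
  let ?Z = "Q \<inter> lattice_points" and ?L = "\<lambda>p. (p, \<omega> p)"
  have K: "K \<omega> = convex hull (?L ` ?Z)" by (simp add: K_def lifted_polytope_def)
  have "F face_of K \<omega>"
  \<comment> \<open>The level of the supporting hyperplane is read off at a point of
    \<open>F\<close>, which leaves the empty set as a separate case.\<close>
  proof (cases "F = {}")
    case False
    then obtain z0 where z0: "z0 \<in> F" by blast
    have "F = K \<omega> \<inter> {z. (a, 1) \<bullet> z = (a, 1) \<bullet> z0}"
      using z0 unfolding F by (auto intro: antisym)
    also have "\<dots> face_of K \<omega>"
      using z0 by (intro face_of_Int_supporting_hyperplane_ge) (auto simp: F K)
    finally show ?thesis .
  qed simp
  then have "F face_of convex hull (?L ` ?Z)" by (simp add: K)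
  moreover have "compact (?L ` ?Z)" using fin by (simp add: finite_imp_compact)
  ultimately obtain C where C: "C \<subseteq> ?L ` ?Z" "F = convex hull C"
    using face_of_convex_hull_subset by blast
  define B where "B = fst ` C"
  have B: "B \<subseteq> ?Z" using C(1) by (auto simp: B_def)
  have "?L (fst z) = z" if "z \<in> C" for z using C(1) that by auto
  then have "?L ` B = C" by (force simp: B_def image_image)
  moreover have "fst ` F = convex hull B"
    by (simp add: C(2) B_def convex_hull_linear_image linear_fst)
  ultimately show thesis using that[OF B] C(2) by simp
qed

text \<open>Replaces the geometry of the lifted polytope by inequalities at lattice points. Weights
  of monomials are sums over such points, so they can be compared in this form, and new heights can
  be verified in it.\<close>

lemma lower_face_iff_supporting:
  fixes Q :: "(real^'d) set"
  assumes fin: "finite (Q \<inter> lattice_points)" and S: "unimodular_simplex S" "S \<subseteq> Q" "S \<noteq> {}"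
  shows "(\<exists>F\<in>lower_faces (lifted_polytope Q \<omega>). S = fst ` F) \<longleftrightarrow>
    (\<exists>a c. \<forall>p\<in>Q \<inter> lattice_points. c \<le> a \<bullet> p + \<omega> p \<and> (a \<bullet> p + \<omega> p = c \<longleftrightarrow> p \<in> S))"
    (is "?lhs \<longleftrightarrow> ?rhs")
proof
  let ?Z = "Q \<inter> lattice_points" and ?L = "\<lambda>p. (p, \<omega> p)" and ?K = "lifted_polytope Q \<omega>"
  have LK: "?L p \<in> ?K" if "p \<in> ?Z" for p
    using that by (simp add: lifted_polytope_def hull_inc)
  have hull: "S = convex hull vertices S" and lat: "S \<inter> lattice_points = vertices S"
    using unimodular_simplex_vertices[OF S(1)] unimodular_simplex_lattice_points[OF S(1)] by auto
  {
    assume ?lhs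
    then obtain a F where F: "F = {z\<in>?K. \<forall>w\<in>?K. (a, 1) \<bullet> z \<le> (a, 1) \<bullet> w}" and SF: "S = fst ` F"
      unfolding lower_faces_def by blast
    obtain B where B: "B \<subseteq> ?Z" "F = convex hull (?L ` B)" "fst ` F = convex hull B"
      using lower_face_of_lifted_polytope[OF fin F] by blast
    obtain z0 where z0: "z0 \<in> F" using S(3) SF by blast
    define c where "c = (a, 1) \<bullet> z0"
    have "c \<le> a \<bullet> p + \<omega> p \<and> (a \<bullet> p + \<omega> p = c \<longleftrightarrow> p \<in> S)" if p: "p \<in> ?Z" for p
    proof -
      have le: "c \<le> (a, 1) \<bullet> ?L p"
        using z0 LK[OF p] unfolding F c_def by blast
      have "?L p \<in> F" if "(a, 1) \<bullet> ?L p = c"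
        using that z0 LK[OF p] unfolding F c_def by auto
      moreover have "?L p \<in> F" if "p \<in> S"
      proof -
        \<comment> \<open>A lattice point of \<open>S\<close> is a vertex and hence one of the
          generators \<open>B\<close> of the projected face. Thus its own lift is in
          \<open>F\<close>, not just some higher point above it.\<close>
        have "p extreme_point_of convex hull B"
          using that p lat SF B(3) by (auto simp: vertices_def)
        then have "p \<in> B" by (rule extreme_point_of_convex_hull)
        then show ?thesis unfolding B(2) by (intro hull_inc) blast
      qed
      moreover have "(a, 1) \<bullet> ?L p = c" if "?L p \<in> F"
        using that z0 unfolding F c_def by (auto intro!: antisym)
      moreover have "p \<in> S" if "?L p \<in> F"
        unfolding SF using that by (rule image_eqI[rotated]) simp
      ultimately have iff: "(a, 1) \<bullet> ?L p = c \<longleftrightarrow> p \<in> S" by blast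
      have "(a, 1) \<bullet> ?L p = a \<bullet> p + \<omega> p" by simp
      then show ?thesis using le iff by (simp only: simp_thms)
    qed
    then show ?rhs by (intro exI ballI)
  next
    assume ?rhs
    then obtain a c where ac: "\<And>p. p \<in> ?Z \<Longrightarrow> c \<le> a \<bullet> p + \<omega> p"
        "\<And>p. p \<in> ?Z \<Longrightarrow> a \<bullet> p + \<omega> p = c \<longleftrightarrow> p \<in> S" by blast
    define F where F: "F = {z\<in>?K. \<forall>w\<in>?K. (a, 1) \<bullet> z \<le> (a, 1) \<bullet> w}"
    obtain B where B: "B \<subseteq> ?Z" "F = convex hull (?L ` B)" "fst ` F = convex hull B"
      using lower_face_of_lifted_polytope[OF fin F] by blast
    have "?K \<subseteq> {z. c \<le> (a, 1) \<bullet> z}"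
      unfolding lifted_polytope_def
      by (intro hull_minimal convex_halfspace_ge) (auto simp: ac(1))
    then have c_le: "c \<le> (a, 1) \<bullet> z" if "z \<in> ?K" for z
      using that by blast
    have VZ: "vertices S \<subseteq> ?Z" using lat S(2) by blast
    have VF: "?L v \<in> F" if "v \<in> vertices S" for v
    proof -
      have "v \<in> S" "v \<in> ?Z" using that VZ lat by auto
      then have "(a, 1) \<bullet> ?L v = c" using ac(2) by simp
      then show ?thesis using c_le LK[OF \<open>v \<in> ?Z\<close>] unfolding F by auto
    qed
    then have "vertices S \<subseteq> fst ` F" by force
    then have "S \<subseteq> fst ` F"
      by (subst hull) (simp add: B(3) hull_minimal convex_convex_hull)
    moreover have "B \<subseteq> S"
    proof
      fix b assume b: "b \<in> B"
      \<comment> \<open>A vertex is a witness that the minimum over the lifted polytope equals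
        \<open>c\<close>; every generator of \<open>F\<close> must then attain \<open>c\<close>
        too.\<close>
      obtain v where v: "v \<in> vertices S" using S(3) hull by fastforce
      have "?L b \<in> F" unfolding B(2) using b by (intro hull_inc) blast
      then have "(a, 1) \<bullet> ?L b \<le> (a, 1) \<bullet> ?L v"
        using VF[OF v] unfolding F by blast
      also have "\<dots> = c" using v VZ lat ac(2)[of v] by auto
      finally show "b \<in> S" using ac[of b] b B(1) by auto
    qed
    then have "fst ` F \<subseteq> S"
      unfolding B(3) by (rule hull_minimal) (subst hull, rule convex_convex_hull)
    ultimately have "S = fst ` F" by blast
    moreover have "F \<in> lower_faces ?K" unfolding lower_faces_def F by blast
    ultimately show ?lhs by blast
  }
qed

text \<open>The empty monomial is listed separately because \<open>\<T>\<close> may have no members when the polytope is empty.\<close>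

definition face_monomial :: "(real^'d) set set \<Rightarrow> (real^'d) multiset \<Rightarrow> bool" where
  "face_monomial \<T> R \<longleftrightarrow> R = {#} \<or> (\<exists>S\<in>\<T>. set_mset R \<subseteq> S)"

lemma inner_sum_mset_right: "a \<bullet> sum_mset R = (\<Sum>p\<in>#R. a \<bullet> p)"
  by (induction R) (simp_all add: inner_add_right)

text \<open>The supporting affine function of a cell containing \<open>R\<close> contributes equally
  to both weights, because \<open>a\<close> sees only the sum and \<open>c\<close> only the degree.
  What remains is the excess over \<open>c\<close>, which is 0 at each point of \<open>R\<close> and
  positive at some point of \<open>R'\<close>.\<close>

lemma face_monomial_weight_less:
  assumes heights: "induced_by_heights Q \<T> \<omega>" and uni: "unimodular_triangulation Q \<T>"
    and fin: "finite (Q \<inter> lattice_points)"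
    and R: "face_monomial \<T> R" "R \<in> monomials (Q \<inter> lattice_points)"
    and R': "R' \<in> monomials (Q \<inter> lattice_points)" "same_fiber R R'" "R \<noteq> R'"
  shows "(\<Sum>p\<in>#R. \<omega> p) < (\<Sum>p\<in>#R'. \<omega> p)"
proof -
  have "R \<noteq> {#}" using R'(2,3) by (auto simp: same_fiber_def)
  then obtain S where S: "S \<in> \<T>" "set_mset R \<subseteq> S" "S \<noteq> {}"
    using R(1) by (auto simp: face_monomial_def)
  have uniS: "unimodular_simplex S" "S \<subseteq> Q"
    using uni S(1) by (auto simp: unimodular_triangulation_def)
  obtain a c where ac: "\<And>p. p \<in> Q \<inter> lattice_points \<Longrightarrow> c \<le> a \<bullet> p + \<omega> p"
      "\<And>p. p \<in> Q \<inter> lattice_points \<Longrightarrow> a \<bullet> p + \<omega> p = c \<longleftrightarrow> p \<in> S"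
  proof -
    have "\<exists>F\<in>lower_faces (lifted_polytope Q \<omega>). S = fst ` F"
      using heights S(1,3) by (simp add: induced_by_heights_def)
    then show thesis
      unfolding lower_face_iff_supporting[OF fin uniS S(3)] using that by blast
  qed
  \<comment> \<open>Within the cell \<open>S\<close> the fiber contains no monomial besides
    \<open>R\<close>.\<close>
  have "\<not> set_mset R' \<subseteq> S"
    using unimodular_simplex_fiber_unique[OF uniS(1), of R R'] R R' S(2)
    by (auto simp: monomials_def)
  then obtain q where "q \<in># R'" and "q \<notin> S" by blast
  moreover from multi_member_split[OF \<open>q \<in># R'\<close>] obtain R0 where "R' = add_mset q R0" by (elim exE)
  ultimately have q: "R' = add_mset q R0" "q \<notin> S" by simp_all
  have "(\<Sum>p\<in>#R. a \<bullet> p + \<omega> p) = (\<Sum>p\<in>#R. c)"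
    using ac(2) R(2) S(2) by (intro arg_cong[of _ _ sum_mset] image_mset_cong) (auto simp: monomials_def)
  also have "\<dots> = (\<Sum>p\<in>#R'. c)"
    using R'(2) by (simp add: same_fiber_def)
  also have "\<dots> = c + (\<Sum>p\<in>#R0. c)" by (simp add: q algebra_simps)
  also have "\<dots> < (a \<bullet> q + \<omega> q) + (\<Sum>p\<in>#R0. a \<bullet> p + \<omega> p)"
  proof (rule add_less_le_mono)
    have "q \<in> Q \<inter> lattice_points" using q(1) R'(1) by (simp add: monomials_def)
    then show "c < a \<bullet> q + \<omega> q" using ac[of q] q(2) by (simp add: order_less_le)
    show "(\<Sum>p\<in>#R0. c) \<le> (\<Sum>p\<in>#R0. a \<bullet> p + \<omega> p)"
      using ac(1) R'(1) q(1) by (intro sum_mset_mono) (auto simp: monomials_def)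
  qed
  also have "\<dots> = (\<Sum>p\<in>#R'. a \<bullet> p + \<omega> p)" by (simp add: q)
  finally have "a \<bullet> sum_mset R + (\<Sum>p\<in>#R. \<omega> p) < a \<bullet> sum_mset R' + (\<Sum>p\<in>#R'. \<omega> p)"
    by (simp add: sum_mset.distrib inner_sum_mset_right)
  then show ?thesis using R'(2) by (simp add: same_fiber_def)
qed

text \<open>The weights differ strictly, so the heights settle the comparison before any tie has to
  be broken.\<close>

lemma face_monomial_is_least_in_fiber:
  assumes "induced_term_order Q \<T> r" "unimodular_triangulation Q \<T>" "finite (Q \<inter> lattice_points)"
    and "face_monomial \<T> R" "R \<in> monomials (Q \<inter> lattice_points)"
    and "R' \<in> monomials (Q \<inter> lattice_points)" "same_fiber R R'" "R \<noteq> R'"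
  shows "(R, R') \<in> r"
proof -
  obtain \<omega> where heights: "induced_by_heights Q \<T> \<omega>"
    and refines: "\<And>R S. R \<in> monomials (Q \<inter> lattice_points) \<Longrightarrow> S \<in> monomials (Q \<inter> lattice_points) \<Longrightarrow>
      size R = size S \<Longrightarrow> (\<Sum>p\<in>#R. \<omega> p) < (\<Sum>p\<in>#S. \<omega> p) \<Longrightarrow> (R, S) \<in> r"
    using assms(1) unfolding induced_term_order_def by metis
  show ?thesis
    using face_monomial_weight_less[OF heights assms(2-)] assms(5-7)
    by (intro refines) (simp_all add: same_fiber_def)
qed

lemma face_monomial_not_leading:
  assumes r: "induced_term_order Q \<T> r" and uni: "unimodular_triangulation Q \<T>"
    and fin: "finite (Q \<inter> lattice_points)"
    and f: "f \<in> toric_ideal Q" "is_leading_monomial r f R"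
  shows "\<not> face_monomial \<T> R"
proof
  assume face: "face_monomial \<T> R"
  have ord: "term_order (Q \<inter> lattice_points) r"
    using r by (simp add: induced_term_order_def)
  have "R \<in> Poly_Mapping.keys f" using f(2) by (simp add: is_leading_monomial_def)
  then obtain R' where R': "R' \<in> Poly_Mapping.keys f" "R' \<noteq> R" "same_fiber R R'"
    using toric_ideal_fiber_partner[OF f(1)] by blast
  have "(R, R') \<in> r"
    using face_monomial_is_least_in_fiber[OF r uni fin face] R' is_leading_monomial_in_monomials[OF ord f(2)]
      \<open>R \<in> Poly_Mapping.keys f\<close> by blast
  moreover have "(R', R) \<in> r" using f(2) R'(1) by (simp add: is_leading_monomial_def)
  ultimately show False
    using ord R'(2) by (auto simp: term_order_def order_on_defs dest: antisymD)
qed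

text \<open>The average of the points of \<open>R\<close> lies in \<open>Q\<close> by convexity,
  hence in some cell; the decomposition of its multiple by \<open>size R\<close> over the vertices
  of that cell is the required monomial.\<close>

lemma face_monomial_in_fiber:
  assumes "convex Q" and uni: "unimodular_triangulation Q \<T>" and R: "R \<in> monomials (Q \<inter> lattice_points)"
  obtains R' where "face_monomial \<T> R'" "R' \<in> monomials (Q \<inter> lattice_points)" "same_fiber R R'"
proof (cases "R = {#}")
  case True
  then show ?thesis using that[of "{#}"] by (simp add: face_monomial_def monomials_def same_fiber_def)
next
  case False
  define n where "n = size R"
  have n: "0 < n" using False by (simp add: n_def nonempty_has_size)
  define x where "x = (\<Sum>v\<in>set_mset R. (real (count R v) / real n) *\<^sub>R v)"
  have "(\<Sum>v\<in>set_mset R. real (count R v) / real n) = 1"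
    using n size_eq_sum_count[of "set_mset R" R] by (simp add: sum_divide_distrib[symmetric] n_def)
  then have "x \<in> Q"
    unfolding x_def using R by (intro convex_sum[OF _ \<open>convex Q\<close>]) (auto simp: monomials_def)
  then obtain S where S: "S \<in> \<T>" "x \<in> S" "unimodular_simplex S" "S \<subseteq> Q"
    using uni unfolding unimodular_triangulation_def by blast
  have sum_R: "real n *\<^sub>R x = sum_mset R"
    using n sum_mset_eq_sum_count[of "set_mset R" R "\<lambda>v. v"] by (simp add: x_def scaleR_sum_right)
  moreover have "sum_mset R \<in> lattice_points"
    using R by (intro lattice_points_sum_mset) (auto simp: monomials_def)
  ultimately obtain R' where R': "set_mset R' \<subseteq> vertices S" "size R' = n" "sum_mset R' = real n *\<^sub>R x"
    using unimodular_simplex_decomposition[OF S(3,2) n] by metis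
  have "set_mset R' \<subseteq> S \<inter> lattice_points"
    using R'(1) unimodular_simplex_vertices(4)[OF S(3)] by blast
  then show ?thesis
    using that[of R'] R' S sum_R by (auto simp: face_monomial_def monomials_def same_fiber_def n_def)
qed

text \<open>The degree two case of the decomposition, taken in a cell through \<open>e / 2\<close>.
  The two vertices, equal or not, span a face because any set of vertices of a simplex does.\<close>

lemma edge_decomposition_exists:
  assumes uni: "unimodular_triangulation P \<T>"
    and e: "e \<in> (*\<^sub>R) 2 ` P" "e \<in> lattice_points"
  obtains e1 e2 where "edge_decomposition P \<T> e e1 e2"
proof -
  obtain x where x: "x \<in> P" "e = 2 *\<^sub>R x" using e(1) by blast
  then obtain S where S: "S \<in> \<T>" "x \<in> S" "unimodular_simplex S" "S \<subseteq> P"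
    using uni unfolding unimodular_triangulation_def by blast
  obtain R where R: "set_mset R \<subseteq> vertices S" "size R = 2" "sum_mset R = e"
    using unimodular_simplex_decomposition[OF S(3,2), of 2] e(2) x(2) by auto
  obtain e1 R1 where R1: "R = add_mset e1 R1"
    using R(2) size_eq_Suc_imp_eq_union[of R 1] by auto
  then obtain e2 where "R1 = {#e2#}"
    using R(2) size_1_singleton_mset[of R1] by auto
  with R1 have R_eq: "R = {#e1, e2#}" by simp
  have "{e1, e2} \<subseteq> vertices S" using R(1) by (simp only: R_eq set_mset_add_mset_insert set_mset_empty)
  then have "\<exists>C. C \<subseteq> vertices S \<and> convex hull {e1, e2} = convex hull C" by blast
  then have "convex hull {e1, e2} face_of convex hull vertices S"
    by (rule face_of_convex_hull_affine_independent[OF unimodular_simplex_vertices(2)[OF S(3)], THEN iffD2])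
  then have "convex hull {e1, e2} face_of S"
    by (simp only: unimodular_simplex_vertices(3)[OF S(3), symmetric])
  moreover have "e1 \<in> S \<inter> lattice_points" "e2 \<in> S \<inter> lattice_points"
    using R(1) unimodular_simplex_vertices(4)[OF S(3)] by (auto simp: R_eq)
  ultimately have "edge_decomposition P \<T> e e1 e2"
    using R(3) S(1,4) by (auto simp: edge_decomposition_def R_eq)
  then show thesis by (rule that)
qed

section \<open>Sign changes\<close>

lemma sign_vectors_cases: "\<sigma> \<in> sign_vectors \<Longrightarrow> \<sigma> $ i = 1 \<or> \<sigma> $ i = -1"
  by (auto simp: sign_vectors_def)

lemma sign_mult_sign_mult [simp]:
  assumes "\<sigma> \<in> sign_vectors"
  shows "\<sigma> * (\<sigma> * x) = x"
proof -
  have "\<sigma> $ i * (\<sigma> $ i * x $ i) = x $ i" for i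
    using sign_vectors_cases[OF assms, of i] by auto
  then show ?thesis by (simp add: vec_eq_iff)
qed

lemma linear_vec_mult: "linear ((*) (a :: real^'d))"
  by (rule linearI) (simp_all add: vec_eq_iff algebra_simps)

lemma inj_sign_mult: "\<sigma> \<in> sign_vectors \<Longrightarrow> inj ((*) \<sigma>)"
  by (rule inj_on_inverseI[of _ "(*) \<sigma>"]) simp

lemma sign_image_iff: "\<sigma> \<in> sign_vectors \<Longrightarrow> x \<in> (*) \<sigma> ` S \<longleftrightarrow> \<sigma> * x \<in> S"
  by (metis imageE image_eqI sign_mult_sign_mult)

lemma sign_mult_lattice_points: "\<sigma> \<in> sign_vectors \<Longrightarrow> x \<in> lattice_points \<Longrightarrow> \<sigma> * x \<in> lattice_points"
  by (auto simp: lattice_points_def sign_vectors_def intro!: Ints_mult)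
    (metis Ints_1 Ints_minus)

lemma finite_sign_vectors: "finite (sign_vectors :: (real^'d) set)"
proof -
  have "sign_vectors \<subseteq> (\<lambda>f. \<chi> i :: 'd. f i) ` (UNIV \<rightarrow>\<^sub>E {-1, 1 :: real})"
  proof
    fix \<sigma> :: "real^'d" assume "\<sigma> \<in> sign_vectors"
    then have "($) \<sigma> \<in> UNIV \<rightarrow>\<^sub>E {-1, 1}" by (auto simp: sign_vectors_def PiE_iff)
    moreover have "\<sigma> = (\<chi> i. \<sigma> $ i)" by simp
    ultimately show "\<sigma> \<in> (\<lambda>f. \<chi> i. f i) ` (UNIV \<rightarrow>\<^sub>E {-1, 1})" by blast
  qed
  then show ?thesis by (rule finite_subset) (intro finite_imageI finite_PiE; simp)
qed

lemma sign_vector_exists: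
  fixes x :: "real^'d"
  obtains \<sigma> where "\<sigma> \<in> sign_vectors" "\<And>i. 0 \<le> (\<sigma> * x) $ i"
  by (rule that[of "\<chi> i. if x $ i < 0 then -1 else 1"]) (auto simp: sign_vectors_def)

lemma sign_mult_eq_abs:
  assumes "\<sigma> \<in> sign_vectors" "\<And>i. 0 \<le> (\<sigma> * x) $ i"
  shows "\<sigma> * x = (\<chi> i. \<bar>x $ i\<bar>)"
proof -
  have "\<sigma> $ i * x $ i = \<bar>x $ i\<bar>" for i
    using sign_vectors_cases[OF assms(1), of i] assms(2)[of i] by auto
  then show ?thesis by (simp add: vec_eq_iff)
qed

text \<open>Signs are free at vanishing coordinates, so the criterion allows every \<sigma> that
  makes \<open>x\<close> nonnegative; later a single \<sigma> has to serve all points of a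
  monomial.\<close>

lemma mem_unconditional_iff:
  assumes "\<sigma> \<in> sign_vectors" "\<And>i. 0 \<le> (\<sigma> * x) $ i"
  shows "x \<in> unconditional P \<longleftrightarrow> \<sigma> * x \<in> P"
  using sign_mult_eq_abs[OF assms] by (simp add: unconditional_def)

lemma sign_mult_mem_unconditional:
  assumes "anti_blocking P" "\<sigma> \<in> sign_vectors" "p \<in> P"
  shows "\<sigma> * p \<in> unconditional P"
  using assms mem_unconditional_iff[of \<sigma> "\<sigma> * p" P] by (simp add: anti_blocking_def)

lemma finite_unconditional_lattice_points:
  fixes P :: "(real^'d) set"
  assumes "finite (P \<inter> lattice_points)"
  shows "finite (unconditional P \<inter> lattice_points)"
proof -
  have "x \<in> (\<Union>\<sigma>\<in>sign_vectors. (*) \<sigma> ` (P \<inter> lattice_points))"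
    if x: "x \<in> unconditional P \<inter> lattice_points" for x :: "real^'d"
  proof -
    obtain \<sigma> :: "real^'d" where \<sigma>: "\<sigma> \<in> sign_vectors" "\<And>i. 0 \<le> (\<sigma> * x) $ i"
      using sign_vector_exists[of x] by blast
    then have "\<sigma> * x \<in> P \<inter> lattice_points"
      using x mem_unconditional_iff[OF \<sigma>] sign_mult_lattice_points[OF \<sigma>(1)] by auto
    then show ?thesis using \<sigma>(1) sign_image_iff[OF \<sigma>(1)] by blast
  qed
  then have "unconditional P \<inter> lattice_points \<subseteq> (\<Union>\<sigma>\<in>sign_vectors. (*) \<sigma> ` (P \<inter> lattice_points))"
    by blast
  then show ?thesis by (rule finite_subset) (simp add: finite_sign_vectors assms)
qed

section \<open>Linear and sign images of simplices\<close>

lemma simplex_linear_image: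
  fixes f :: "'a::euclidean_space \<Rightarrow> 'b::euclidean_space"
  assumes "linear f" "inj f" "n simplex S"
  shows "n simplex (f ` S)"
proof -
  obtain C where C: "\<not> affine_dependent C" "int (card C) = n + 1" "S = convex hull C"
    using assms(3) by (auto simp: simplex_def)
  have "x \<in> affine hull (C - {x})" if "f x \<in> affine hull (f ` C - {f x})" for x
  proof -
    have "f ` C - {f x} = f ` (C - {x})"
      using assms(2) by (auto simp: inj_def)
    then have "f x \<in> f ` (affine hull (C - {x}))"
      using that assms(1) by (simp add: affine_hull_linear_image linear_conv_bounded_linear)
    then show ?thesis using assms(2) by (auto simp: inj_def)
  qed
  then have "\<not> affine_dependent (f ` C)"
    using C(1) by (auto simp: affine_dependent_def)
  moreover have "card (f ` C) = card C"
    using assms(2) by (intro card_image) (rule inj_on_subset, auto)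
  moreover have "f ` S = convex hull (f ` C)"
    by (simp add: C(3) convex_hull_linear_image assms(1))
  ultimately show ?thesis using C(2) unfolding simplex_def by metis
qed

lemma vertices_linear_image:
  fixes f :: "real^'d \<Rightarrow> real^'e"
  assumes "linear f" "inj f"
  shows "vertices (f ` S) = f ` vertices S"
proof -
  have ext: "f x extreme_point_of f ` S \<longleftrightarrow> x extreme_point_of S" for x
    using face_of_linear_image[OF assms, of "{x}" S] by (simp add: face_of_singleton)
  have "y \<in> f ` S" if "y extreme_point_of f ` S" for y
    using that by (simp add: extreme_point_of_def)
  then show ?thesis unfolding vertices_def using ext by blast
qed

text \<open>A sign change is a linear automorphism of the lattice and its own inverse, so edge
  coordinates are obtained by pulling the point back to \<open>S\<close>.\<close>

lemma unimodular_simplex_sign_image: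
  fixes S :: "(real^'d) set"
  assumes \<sigma>: "\<sigma> \<in> sign_vectors" and S: "unimodular_simplex S"
  shows "unimodular_simplex ((*) \<sigma> ` S)"
proof -
  note lin = linear_vec_mult[of \<sigma>] inj_sign_mult[OF \<sigma>]
  have V: "vertices ((*) \<sigma> ` S) = (*) \<sigma> ` vertices S"
    by (rule vertices_linear_image[OF lin])
  have "\<exists>n. n simplex ((*) \<sigma> ` S)"
    using S simplex_linear_image[OF lin] by (auto simp: unimodular_simplex_def)
  moreover have "vertices ((*) \<sigma> ` S) \<subseteq> lattice_points"
    using S \<sigma> by (auto simp: V unimodular_simplex_def intro: sign_mult_lattice_points)
  moreover have "\<exists>c :: real^'d \<Rightarrow> int. x - w = (\<Sum>v\<in>vertices ((*) \<sigma> ` S) - {w}. of_int (c v) *\<^sub>R (v - w))"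
    if w: "w \<in> vertices ((*) \<sigma> ` S)" and x: "x \<in> lattice_points \<inter> affine hull ((*) \<sigma> ` S)" for w x
  proof -
    obtain v0 where v0: "v0 \<in> vertices S" "w = \<sigma> * v0" using w by (auto simp: V)
    have "x \<in> (*) \<sigma> ` (affine hull S)"
      using x affine_hull_linear_image[of "(*) \<sigma>" S] lin(1)
      by (simp add: linear_conv_bounded_linear)
    then have "\<sigma> * x \<in> lattice_points \<inter> affine hull S"
      using x \<sigma> by (simp add: sign_image_iff sign_mult_lattice_points)
    then obtain c :: "real^'d \<Rightarrow> int"
      where c: "\<sigma> * x - v0 = (\<Sum>v\<in>vertices S - {v0}. of_int (c v) *\<^sub>R (v - v0))"
      using S v0(1) unfolding unimodular_simplex_def by blast
    have diff: "vertices ((*) \<sigma> ` S) - {w} = (*) \<sigma> ` (vertices S - {v0})"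
      using lin(2) by (auto simp: V v0(2) inj_def)
    have "x - w = \<sigma> * (\<sigma> * x - v0)"
      using \<sigma> by (simp add: v0(2) right_diff_distrib)
    also have "\<dots> = (\<Sum>v\<in>vertices S - {v0}. of_int (c v) *\<^sub>R (\<sigma> * v - w))"
      using lin(1) by (simp add: c linear_sum linear_scale v0(2) right_diff_distrib)
    also have "\<dots> = (\<Sum>v\<in>vertices ((*) \<sigma> ` S) - {w}. of_int (c (\<sigma> * v)) *\<^sub>R (v - w))"
      unfolding diff using \<sigma> lin(2) by (subst sum.reindex) (auto intro: inj_on_subset)
    finally show ?thesis by (intro exI[of _ "\<lambda>v. c (\<sigma> * v)"])
  qed
  ultimately show ?thesis unfolding unimodular_simplex_def by blast
qed

text \<open>A common point of the two images vanishes wherever the signs differ, hence has the same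
  preimage in \<open>S\<close> and \<open>S'\<close>. The intersection is thus the image of a part
  of \<open>S \<inter> S'\<close> cut out by vanishing coordinates, and both constraints define
  faces of \<open>S\<close>.\<close>

lemma sign_image_Int_face_of:
  fixes S S' :: "(real^'d) set"
  assumes \<sigma>: "\<sigma> \<in> sign_vectors" and \<tau>: "\<tau> \<in> sign_vectors"
    and nonneg: "\<And>x i. x \<in> S \<union> S' \<Longrightarrow> 0 \<le> x $ i"
    and "convex S" and face: "S \<inter> S' face_of S"
  shows "(*) \<sigma> ` S \<inter> (*) \<tau> ` S' face_of (*) \<sigma> ` S"
proof -
  \<comment> \<open>The indicator of the coordinates with differing signs is a functional that is
    nonnegative on \<open>S\<close>, and its zero set on \<open>S\<close> is where all of these
    coordinates vanish.\<close>
  define a :: "real^'d" where "a = (\<chi> i. if \<sigma> $ i \<noteq> \<tau> $ i then 1 else 0)"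
  have a_eq_0: "a \<bullet> y = 0 \<longleftrightarrow> (\<forall>i. \<sigma> $ i \<noteq> \<tau> $ i \<longrightarrow> y $ i = 0)" and a_ge_0: "0 \<le> a \<bullet> y"
    if "y \<in> S" for y
  proof -
    have "0 \<le> a $ i * y $ i" for i using nonneg that by (simp add: a_def)
    moreover have "a $ i = 0 \<longleftrightarrow> \<sigma> $ i = \<tau> $ i" for i by (simp add: a_def)
    ultimately show "a \<bullet> y = 0 \<longleftrightarrow> (\<forall>i. \<sigma> $ i \<noteq> \<tau> $ i \<longrightarrow> y $ i = 0)" "0 \<le> a \<bullet> y"
      by (auto simp: inner_vec_def sum_nonneg_eq_0_iff sum_nonneg)
  qed
  have "x \<in> (*) \<sigma> ` S \<inter> (*) \<tau> ` S' \<longleftrightarrow> x \<in> (*) \<sigma> ` (S \<inter> S' \<inter> (S \<inter> {y. a \<bullet> y = 0}))" for x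
  proof
    assume "x \<in> (*) \<sigma> ` S \<inter> (*) \<tau> ` S'"
    then have x: "\<sigma> * x \<in> S" "\<tau> * x \<in> S'" using \<sigma> \<tau> by (auto simp: sign_image_iff)
    have zero: "x $ i = 0" if "\<sigma> $ i \<noteq> \<tau> $ i" for i
      using nonneg[of "\<sigma> * x" i] nonneg[of "\<tau> * x" i] x that
        sign_vectors_cases[OF \<sigma>, of i] sign_vectors_cases[OF \<tau>, of i] by auto
    then have "\<sigma> * x = \<tau> * x" by (auto simp: vec_eq_iff)
    then show "x \<in> (*) \<sigma> ` (S \<inter> S' \<inter> (S \<inter> {y. a \<bullet> y = 0}))"
      using x zero a_eq_0[OF x(1)] by (simp add: sign_image_iff[OF \<sigma>])
  next
    assume "x \<in> (*) \<sigma> ` (S \<inter> S' \<inter> (S \<inter> {y. a \<bullet> y = 0}))"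
    then have x: "\<sigma> * x \<in> S" "\<sigma> * x \<in> S'" "a \<bullet> (\<sigma> * x) = 0" by (auto simp: sign_image_iff[OF \<sigma>])
    have "\<sigma> $ i * x $ i = \<tau> $ i * x $ i" for i
      using x(3) a_eq_0[OF x(1)] sign_vectors_cases[OF \<sigma>, of i] by (cases "\<sigma> $ i = \<tau> $ i") auto
    then have "\<sigma> * x = \<tau> * x" by (simp add: vec_eq_iff)
    then show "x \<in> (*) \<sigma> ` S \<inter> (*) \<tau> ` S'"
      using x \<sigma> \<tau> by (simp add: sign_image_iff)
  qed
  then have "(*) \<sigma> ` S \<inter> (*) \<tau> ` S' = (*) \<sigma> ` (S \<inter> S' \<inter> (S \<inter> {y. a \<bullet> y = 0}))" by blast
  moreover have "S \<inter> {y. a \<bullet> y = 0} face_of S"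
    by (intro face_of_Int_supporting_hyperplane_ge \<open>convex S\<close> a_ge_0)
  then have "S \<inter> S' \<inter> (S \<inter> {y. a \<bullet> y = 0}) face_of S"
    using face face_of_Int by blast
  ultimately show ?thesis
    using face_of_linear_image[OF linear_vec_mult inj_sign_mult[OF \<sigma>]] by simp
qed

lemma unimodular_triangulation_signed:
  fixes P :: "(real^'d) set"
  assumes P: "anti_blocking P" and uni: "unimodular_triangulation P \<T>"
  shows "unimodular_triangulation (unconditional P) (signed_triangulation \<T>)"
proof -
  have tri: "triangulation \<T>" and cover: "\<Union>\<T> = P" and simp: "\<And>S. S \<in> \<T> \<Longrightarrow> unimodular_simplex S"
    using uni by (auto simp: unimodular_triangulation_def)
  have "signed_triangulation \<T> = (\<lambda>(\<sigma>, S). (*) \<sigma> ` S) ` (sign_vectors \<times> \<T>)"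
    by (auto simp: signed_triangulation_def)
  then have "finite (signed_triangulation \<T>)"
    using tri by (simp add: triangulation_def finite_sign_vectors)
  moreover have uni': "unimodular_simplex S" if "S \<in> signed_triangulation \<T>" for S
    using that simp unimodular_simplex_sign_image by (auto simp: signed_triangulation_def)
  moreover have "T \<inter> T' face_of T"
    if "T \<in> signed_triangulation \<T>" "T' \<in> signed_triangulation \<T>" for T T'
  proof -
    obtain \<sigma> S where S: "\<sigma> \<in> sign_vectors" "S \<in> \<T>" "T = (*) \<sigma> ` S"
      using \<open>T \<in> _\<close> by (auto simp: signed_triangulation_def)
    obtain \<tau> S' where S': "\<tau> \<in> sign_vectors" "S' \<in> \<T>" "T' = (*) \<tau> ` S'"
      using \<open>T' \<in> _\<close> by (auto simp: signed_triangulation_def)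
    have "0 \<le> x $ i" if "x \<in> S \<union> S'" for x i
      using that P cover S(2) S'(2) by (auto simp: anti_blocking_def)
    moreover have "convex S"
      using tri S(2) by (auto simp: triangulation_def simplex_def)
    moreover have "S \<inter> S' face_of S"
      using tri S(2) S'(2) by (simp add: triangulation_def)
    ultimately show ?thesis
      unfolding S(3) S'(3) by (intro sign_image_Int_face_of S(1) S'(1))
  qed
  ultimately have "triangulation (signed_triangulation \<T>)"
    unfolding triangulation_def by (auto simp: unimodular_simplex_def)
  moreover have "\<Union>(signed_triangulation \<T>) = unconditional P"
  proof
    show "\<Union>(signed_triangulation \<T>) \<subseteq> unconditional P"
      using cover sign_mult_mem_unconditional[OF P] by (auto simp: signed_triangulation_def)
    show "unconditional P \<subseteq> \<Union>(signed_triangulation \<T>)"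
    proof
      fix x assume x: "x \<in> unconditional P"
      obtain \<sigma> :: "real^'d" where \<sigma>: "\<sigma> \<in> sign_vectors" "\<And>i. 0 \<le> (\<sigma> * x) $ i"
        using sign_vector_exists[of x] by blast
      then obtain S where "S \<in> \<T>" "\<sigma> * x \<in> S"
        using x mem_unconditional_iff[OF \<sigma>] cover by blast
      then show "x \<in> \<Union>(signed_triangulation \<T>)"
        using \<sigma>(1) sign_image_iff[OF \<sigma>(1), of x S]
        by (intro UnionI[of "(*) \<sigma> ` S"]) (auto simp: signed_triangulation_def)
    qed
  qed
  ultimately show ?thesis using uni' by (simp add: unimodular_triangulation_def)
qed

text \<open>For the cell \<open>\<sigma> S\<close>, the excess of the new heights over a suitable
  affine function splits at \<open>p\<close> into the excess for \<open>S\<close> at the reflected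
  point of \<open>P\<close> and a penalty \<open>D\<close> for leaving the orthant of \<sigma>. Both
  vanish together exactly on the cell.\<close>

lemma regular_triangulation_signed:
  fixes P :: "(real^'d) set"
  assumes P: "anti_blocking P" and fin: "finite (P \<inter> lattice_points)"
    and uni: "unimodular_triangulation P \<T>" and reg: "regular_triangulation P \<T>"
  shows "regular_triangulation (unconditional P) (signed_triangulation \<T>)"
proof -
  obtain \<omega> where \<omega>: "induced_by_heights P \<T> \<omega>"
    using reg by (auto simp: regular_triangulation_def)
  have cells: "unimodular_simplex S" "S \<subseteq> P" if "S \<in> \<T>" for S
    using uni that by (auto simp: unimodular_triangulation_def)
  have "\<forall>S\<in>\<T> - {{}}. \<exists>a c. \<forall>p\<in>P \<inter> lattice_points.
      c \<le> a \<bullet> p + \<omega> p \<and> (a \<bullet> p + \<omega> p = c \<longleftrightarrow> p \<in> S)"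
  proof
    fix S assume S: "S \<in> \<T> - {{}}"
    then have "\<exists>F\<in>lower_faces (lifted_polytope P \<omega>). S = fst ` F"
      using \<omega> by (auto simp: induced_by_heights_def)
    then show "\<exists>a c. \<forall>p\<in>P \<inter> lattice_points. c \<le> a \<bullet> p + \<omega> p \<and> (a \<bullet> p + \<omega> p = c \<longleftrightarrow> p \<in> S)"
      using S by (subst (asm) lower_face_iff_supporting[OF fin cells]) auto
  qed
  then obtain a c where ac: "\<And>S p. S \<in> \<T> - {{}} \<Longrightarrow> p \<in> P \<inter> lattice_points \<Longrightarrow>
      c S \<le> a S \<bullet> p + \<omega> p \<and> (a S \<bullet> p + \<omega> p = c S \<longleftrightarrow> p \<in> S)"
    by metis
  define A where "A = (\<lambda>(S, i). a S $ i) ` (\<T> \<times> UNIV)"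
  \<comment> \<open>\<open>N\<close> has to exceed strictly every coordinate of every slope
    \<open>a S\<close>, so that crossing a coordinate hyperplane always costs something. Inserting 0
    keeps \<open>Max\<close> meaningful when there are no cells.\<close>
  define N where "N = Max (insert 0 A) + 1"
  have "finite A" using uni by (simp add: A_def unimodular_triangulation_def triangulation_def)
  have N: "a S $ i < N" if "S \<in> \<T>" for S i
  proof -
    have "a S $ i \<in> A" using that by (force simp: A_def)
    then have "a S $ i \<le> Max (insert 0 A)" using \<open>finite A\<close> by (intro Max_ge) auto
    then show ?thesis by (simp add: N_def)
  qed
  \<comment> \<open>Penalising the 1-norm makes the folds along the coordinate hyperplanes convex.\<close>
  define \<omega>' where "\<omega>' p = \<omega> (\<chi> i. \<bar>p $ i\<bar>) + N * (\<Sum>i\<in>UNIV. \<bar>p $ i\<bar>)" for p :: "real^'d"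
  have uni': "unimodular_triangulation (unconditional P) (signed_triangulation \<T>)"
    by (rule unimodular_triangulation_signed[OF P uni])
  have fin': "finite (unconditional P \<inter> lattice_points)"
    by (rule finite_unconditional_lattice_points[OF fin])
  have "\<exists>F\<in>lower_faces (lifted_polytope (unconditional P) \<omega>'). T = fst ` F"
    if T: "T \<in> signed_triangulation \<T>" "T \<noteq> {}" for T
  proof -
    obtain \<sigma> S where S: "\<sigma> \<in> sign_vectors" "S \<in> \<T>" "T = (*) \<sigma> ` S"
      using T(1) by (auto simp: signed_triangulation_def)
    have ne: "S \<in> \<T> - {{}}" using S T(2) by auto
    \<comment> \<open>The slope of \<open>S\<close> reflected by \<sigma>; subtracting
      \<open>N\<close> cancels the 1-norm term inside the orthant of \<sigma>.\<close>
    define a' where "a' = (\<chi> i. \<sigma> $ i * (a S $ i - N))"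
    have "c S \<le> a' \<bullet> p + \<omega>' p \<and> (a' \<bullet> p + \<omega>' p = c S \<longleftrightarrow> p \<in> T)"
      if p: "p \<in> unconditional P \<inter> lattice_points" for p
    proof -
      define q where "q = (\<chi> i. \<bar>p $ i\<bar>)"
      \<comment> \<open>A summand is zero exactly when \<open>p $ i\<close> agrees with the sign
        \<open>\<sigma> $ i\<close> or vanishes, since its other factor \<open>N - a S $ i\<close>
        is positive.\<close>
      define D where "D = (\<Sum>i\<in>UNIV. (N - a S $ i) * (\<bar>p $ i\<bar> - \<sigma> $ i * p $ i))"
      have q: "q \<in> P \<inter> lattice_points"
        using p by (auto simp: q_def unconditional_def lattice_points_def)
      have "a' \<bullet> p + N * (\<Sum>i\<in>UNIV. \<bar>p $ i\<bar>) = a S \<bullet> q + D"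
        unfolding inner_vec_def D_def a'_def q_def sum_distrib_left sum.distrib[symmetric]
        by (intro sum.cong) (simp_all add: algebra_simps)
      then have eq: "a' \<bullet> p + \<omega>' p = (a S \<bullet> q + \<omega> q) + D"
        by (simp add: \<omega>'_def q_def)
      have "\<sigma> $ i * p $ i \<le> \<bar>p $ i\<bar>" for i
        using sign_vectors_cases[OF S(1), of i] by auto
      then have summand: "0 \<le> (N - a S $ i) * (\<bar>p $ i\<bar> - \<sigma> $ i * p $ i)" for i
        using N[OF S(2), of i] by (simp add: less_imp_le)
      then have D: "0 \<le> D" by (simp add: D_def sum_nonneg)
      have "D = 0 \<longleftrightarrow> (\<forall>i. \<bar>p $ i\<bar> = \<sigma> $ i * p $ i)"
        using summand N[OF S(2)] less_irrefl
        by (auto simp: D_def sum_nonneg_eq_0_iff) (metis less_irrefl)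
      then have "D = 0 \<longleftrightarrow> q = \<sigma> * p"
        by (simp add: q_def vec_eq_iff)
      moreover have "q = \<sigma> * p" if "\<sigma> * p \<in> S"
      proof -
        have "\<sigma> * p \<in> P" using that cells(2)[OF S(2)] by blast
        then have "0 \<le> (\<sigma> * p) $ i" for i using P unfolding anti_blocking_def by blast
        then show ?thesis using sign_mult_eq_abs[OF S(1)] by (simp only: q_def)
      qed
      ultimately have "D = 0 \<and> q \<in> S \<longleftrightarrow> p \<in> T"
        using S(1,3) by (auto simp: sign_image_iff)
      then show ?thesis
        using ac[OF ne q] D unfolding eq by auto
    qed
    then have "\<exists>a c. \<forall>p\<in>unconditional P \<inter> lattice_points.
        c \<le> a \<bullet> p + \<omega>' p \<and> (a \<bullet> p + \<omega>' p = c \<longleftrightarrow> p \<in> T)" by (intro exI ballI)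
    moreover have "unimodular_simplex T" "T \<subseteq> unconditional P"
      using uni' T(1) by (auto simp: unimodular_triangulation_def)
    ultimately show ?thesis using lower_face_iff_supporting[OF fin' _ _ T(2)] by simp
  qed
  then have "induced_by_heights (unconditional P) (signed_triangulation \<T>) \<omega>'"
    using uni' by (simp add: induced_by_heights_def unimodular_triangulation_def)
  then show ?thesis by (auto simp: regular_triangulation_def)
qed

section \<open>Groebner bases\<close>

text \<open>The common source of all markings: a trailing face monomial is least in its fiber for
  every order induced by the triangulation.\<close>

lemma binomial_leading_monomial:
  assumes "induced_term_order Q \<T> r" "unimodular_triangulation Q \<T>" "finite (Q \<inter> lattice_points)"
    and "A \<in> monomials (Q \<inter> lattice_points)" "B \<in> monomials (Q \<inter> lattice_points)"
    and "same_fiber A B" "A \<noteq> B" "face_monomial \<T> B"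
  shows "is_leading_monomial r (mon A - mon B) A"
proof (rule is_leading_monomial_binomial)
  show "term_order (Q \<inter> lattice_points) r"
    using assms(1) by (simp add: induced_term_order_def)
  show "(B, A) \<in> r"
    using assms by (intro face_monomial_is_least_in_fiber[OF assms(1-3)]) (auto simp: same_fiber_def)
qed (use assms in auto)

text \<open>Subtracting from \<open>R\<close> the face monomial of its fiber gives an element of the
  toric ideal led by \<open>R\<close>; so every non-face monomial is in the leading ideal.\<close>

lemma nonface_monomial_divisible:
  assumes "convex Q" and r: "induced_term_order Q \<T> r" and uni: "unimodular_triangulation Q \<T>"
    and fin: "finite (Q \<inter> lattice_points)"
    and G: "groebner_basis (Q \<inter> lattice_points) r (toric_ideal Q) G"
    and R: "R \<in> monomials (Q \<inter> lattice_points)" "\<not> face_monomial \<T> R"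
  obtains g A where "g \<in> G" "is_leading_monomial r g A" "A \<subseteq># R"
proof -
  obtain R' where R': "face_monomial \<T> R'" "R' \<in> monomials (Q \<inter> lattice_points)" "same_fiber R R'"
    using face_monomial_in_fiber[OF \<open>convex Q\<close> uni R(1)] by blast
  have "R \<noteq> R'" using R(2) R'(1) by blast
  then have "is_leading_monomial r (mon R - mon R') R"
    by (rule binomial_leading_monomial[OF r uni fin R(1) R'(2,3) _ R'(1)])
  then have "mon R \<in> leading_ideal (Q \<inter> lattice_points) r (toric_ideal Q)"
    using binomial_in_toric_ideal[OF R(1) R'(2,3)] R(1) by (intro mon_in_leading_ideal[of _ _ r R]) simp_all
  then have "mon R \<in> leading_ideal (Q \<inter> lattice_points) r G"
    using G by (simp add: groebner_basis_def)
  then show thesis using that by (rule leading_ideal_mon_dvd)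
qed

text \<open>\<open>binomials\<close> forgets which term was marked; the leading monomial recovers
  it.\<close>

lemma correctly_marked_unique:
  assumes "term_order Z r" "correctly_marked r M" "g \<in> binomials M" "is_leading_monomial r g A"
  obtains B where "(A, B) \<in> M" "g = mon A - mon B"
proof -
  obtain A' B where AB: "(A', B) \<in> M" "g = mon A' - mon B"
    using assms(3) by (auto simp: binomials_def)
  then have "is_leading_monomial r g A'"
    using assms(2) by (auto simp: correctly_marked_def)
  then have "A' = A" using assms(1,4) is_leading_monomial_unique by blast
  then show thesis using that AB by blast
qed

text \<open>Extracts from the reduced basis properties that do not mention \<open>r\<close> and are
  therefore stable under sign changes.\<close>

lemma reduced_groebner_basis_binomial:
  assumes "convex Q" and r: "induced_term_order Q \<T> r" and uni: "unimodular_triangulation Q \<T>"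
    and fin: "finite (Q \<inter> lattice_points)"
    and G: "reduced_groebner_basis (Q \<inter> lattice_points) r (toric_ideal Q) (binomials M)"
    and M: "correctly_marked r M" "(A, B) \<in> M"
  shows "A \<in> monomials (Q \<inter> lattice_points)" "B \<in> monomials (Q \<inter> lattice_points)"
    "same_fiber A B" "A \<noteq> B" "face_monomial \<T> B"
proof -
  let ?Z = "Q \<inter> lattice_points" and ?g = "mon A - mon B"
  have ord: "term_order ?Z r" using r by (simp add: induced_term_order_def)
  have g: "?g \<in> binomials M" using M(2) by (force simp: binomials_def)
  have lead: "is_leading_monomial r ?g A" using M by (auto simp: correctly_marked_def)
  have groebner: "groebner_basis ?Z r (toric_ideal Q) (binomials M)"
    using G by (simp add: reduced_groebner_basis_def)
  show ne: "A \<noteq> B" using lead by (auto simp: is_leading_monomial_def)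
  then have keys: "Poly_Mapping.keys ?g = {A, B}" by (rule keys_mon_diff_mon)
  then show "A \<in> monomials ?Z" and B: "B \<in> monomials ?Z"
    using is_leading_monomial_in_monomials[OF ord lead] by auto
  show fiber: "same_fiber A B"
    using groebner g by (intro binomial_toric_ideal_same_fiber[of A B Q]) (auto simp: groebner_basis_def)
  show "face_monomial \<T> B"
  proof (rule ccontr)
    assume "\<not> face_monomial \<T> B"
    then obtain h C where h: "h \<in> binomials M" "is_leading_monomial r h C" "C \<subseteq># B"
      using nonface_monomial_divisible[OF \<open>convex Q\<close> r uni fin groebner B] by blast
    show False
    \<comment> \<open>If the divisor of \<open>B\<close> is the leading term of the binomial itself,
      equal degrees force \<open>A = B\<close>; if it comes from another basis element, reducedness
      is violated.\<close>
    proof (cases "h = ?g")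
      case True
      then have "C = A" using is_leading_monomial_unique[OF ord h(2)] lead by simp
      then have "A = B"
        using h(3) fiber by (metis mset_subset_size order_less_irrefl same_fiber_def subset_mset.le_imp_less_or_eq)
      with ne show False by simp
    next
      case False
      then have "mon B \<in> leading_ideal ?Z r (binomials M - {?g})"
        using h B by (intro mon_in_leading_ideal[of h _ r C]) auto
      moreover have "B \<in> Poly_Mapping.keys ?g" by (simp add: keys)
      ultimately show False using G g unfolding reduced_groebner_basis_def by blast
    qed
  qed
qed

section \<open>Sign images of monomials and marked binomials\<close>

lemma sum_mset_sign_mult: "sum_mset (image_mset ((*) \<sigma>) R) = (\<sigma> :: real^'d) * sum_mset R"
  by (induction R) (simp_all add: distrib_left)

lemma sign_mult_monomials:
  assumes "anti_blocking P" "\<sigma> \<in> sign_vectors" "R \<in> monomials (P \<inter> lattice_points)"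
  shows "image_mset ((*) \<sigma>) R \<in> monomials (unconditional P \<inter> lattice_points)"
  using assms by (auto simp: monomials_def intro: sign_mult_mem_unconditional sign_mult_lattice_points)

lemma face_monomial_signed:
  assumes "\<sigma> \<in> sign_vectors" "face_monomial \<T> R"
  shows "face_monomial (signed_triangulation \<T>) (image_mset ((*) \<sigma>) R)"
  using assms unfolding face_monomial_def signed_triangulation_def by (auto intro!: image_mono)

lemma image_mset_sign_sign [simp]:
  "\<sigma> \<in> sign_vectors \<Longrightarrow> image_mset ((*) \<sigma>) (image_mset ((*) \<sigma>) R) = R"
  by (simp add: multiset.map_comp comp_def)

lemma signed_binomials_properties:
  assumes P: "anti_blocking P"
    and M: "\<And>A B. (A, B) \<in> M \<Longrightarrow> A \<in> monomials (P \<inter> lattice_points) \<and> B \<in> monomials (P \<inter> lattice_points) \<and>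
      same_fiber A B \<and> A \<noteq> B \<and> face_monomial \<T> B"
    and AB: "(A, B) \<in> signed_binomials M"
  shows "A \<in> monomials (unconditional P \<inter> lattice_points) \<and> B \<in> monomials (unconditional P \<inter> lattice_points) \<and>
    same_fiber A B \<and> A \<noteq> B \<and> face_monomial (signed_triangulation \<T>) B"
proof -
  obtain \<sigma> A0 B0 where \<sigma>: "\<sigma> \<in> sign_vectors" "(A0, B0) \<in> M"
    and eq: "A = image_mset ((*) \<sigma>) A0" "B = image_mset ((*) \<sigma>) B0"
    using AB by (auto simp: signed_binomials_def)
  note 0 = M[OF \<sigma>(2)]
  have "A \<noteq> B"
    using 0 image_mset_sign_sign[OF \<sigma>(1), of A0] image_mset_sign_sign[OF \<sigma>(1), of B0]
    by (auto simp: eq)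
  moreover have "same_fiber A B"
    using 0 by (simp add: eq same_fiber_def sum_mset_sign_mult)
  ultimately show ?thesis
    using 0 sign_mult_monomials[OF P \<sigma>(1)] face_monomial_signed[OF \<sigma>(1)] by (simp add: eq)
qed

section \<open>Separable pairs\<close>

lemma separable_not_in_orthant:
  assumes "\<sigma> \<in> sign_vectors" "separable p q" "\<And>i. 0 \<le> (\<sigma> * p) $ i" "\<And>i. 0 \<le> (\<sigma> * q) $ i"
  shows False
proof -
  obtain i where i: "p $ i < 0 \<and> 0 < q $ i \<or> 0 < p $ i \<and> q $ i < 0"
    using assms(2) by (auto simp: separable_def)
  show False
    using sign_vectors_cases[OF assms(1), of i] i assms(3)[of i] assms(4)[of i] by auto
qed

lemma separable_binomials_properties:
  fixes P :: "(real^'d) set"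
  assumes P: "anti_blocking P"
    and AB: "(A, B) \<in> separable_binomials P \<T>"
  shows "A \<in> monomials (unconditional P \<inter> lattice_points) \<and> B \<in> monomials (unconditional P \<inter> lattice_points) \<and>
    same_fiber A B \<and> A \<noteq> B \<and> face_monomial (signed_triangulation \<T>) B"
proof -
  obtain p q \<sigma> e1 e2 where AB_eq: "A = {#p, q#}" "B = {#\<sigma> * e1, \<sigma> * e2#}"
    and pq: "p \<in> unconditional P \<inter> lattice_points" "q \<in> unconditional P \<inter> lattice_points" "separable p q"
    and \<sigma>: "\<sigma> \<in> sign_vectors" and edge: "edge_decomposition P \<T> (\<sigma> * (p + q)) e1 e2"
    using AB unfolding separable_binomials_def by blast
  have e: "e1 \<in> P \<inter> lattice_points" "e2 \<in> P \<inter> lattice_points" "\<sigma> * (p + q) = e1 + e2"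
    using edge by (auto simp: edge_decomposition_def)
  have B: "B = image_mset ((*) \<sigma>) {#e1, e2#}" by (simp add: AB_eq)
  have "A \<in> monomials (unconditional P \<inter> lattice_points)"
    using pq by (simp add: AB_eq monomials_def)
  moreover have "B \<in> monomials (unconditional P \<inter> lattice_points)"
    unfolding B using e by (intro sign_mult_monomials P \<sigma>) (simp add: monomials_def)
  moreover have "same_fiber A B"
  proof -
    have "p + q = \<sigma> * (e1 + e2)" using e(3) sign_mult_sign_mult[OF \<sigma>, of "p + q"] by simp
    then show ?thesis by (simp add: AB_eq same_fiber_def distrib_left)
  qed
  moreover have "A \<noteq> B"
  proof
    assume "A = B"
    \<comment> \<open>The trailing points both lie in the orthant of \<sigma>; equality of the
      monomials would put the separable points \<open>p\<close> and \<open>q\<close> into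
      it.\<close>
    have "p \<in># A" "q \<in># A" by (simp_all add: AB_eq(1))
    then have "p \<in># B" "q \<in># B" by (simp_all only: \<open>A = B\<close>)
    then have "p \<in> (*) \<sigma> ` P" "q \<in> (*) \<sigma> ` P" using e by (auto simp: AB_eq(2))
    then have "\<sigma> * p \<in> P" "\<sigma> * q \<in> P" using \<sigma> by (simp_all add: sign_image_iff)
    then show False
      using separable_not_in_orthant[OF \<sigma> pq(3)] P unfolding anti_blocking_def by blast
  qed
  moreover have "face_monomial \<T> {#e1, e2#}"
  proof -
    obtain S where S: "S \<in> \<T>" "convex hull {e1, e2} face_of S"
      using edge by (auto simp: edge_decomposition_def)
    have "{e1, e2} \<subseteq> S" using face_of_imp_subset[OF S(2)] hull_subset[of "{e1, e2}" convex] by blast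
    then show ?thesis using S(1) by (auto simp: face_monomial_def)
  qed
  then have "face_monomial (signed_triangulation \<T>) B"
    unfolding B by (rule face_monomial_signed[OF \<sigma>])
  ultimately show ?thesis by blast
qed

text \<open>Only the membership of \<open>e\<close> in \<open>2 P\<close> needs an argument. By the
  triangle inequality in each coordinate, half of \<open>e\<close> is dominated by the average of
  the reflections of \<open>p\<close> and \<open>q\<close> into \<open>P\<close>, so convexity and
  anti-blocking put it into \<open>P\<close>.\<close>

lemma separable_pair_marked:
  fixes P :: "(real^'d) set"
  assumes P: "anti_blocking P" "convex P" and uni: "unimodular_triangulation P \<T>"
    and pq: "p \<in> unconditional P \<inter> lattice_points" "q \<in> unconditional P \<inter> lattice_points" "separable p q"
  obtains B where "({#p, q#}, B) \<in> separable_binomials P \<T>"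
proof -
  \<comment> \<open>The signs are those of the sum, as no single orthant contains both
    \<open>p\<close> and \<open>q\<close>.\<close>
  obtain \<sigma> :: "real^'d" where \<sigma>: "\<sigma> \<in> sign_vectors" "\<And>i. 0 \<le> (\<sigma> * (p + q)) $ i"
    using sign_vector_exists[of "p + q"] by blast
  define e where "e = \<sigma> * (p + q)"
  have e_abs: "e $ i = \<bar>p $ i + q $ i\<bar>" for i
    using sign_mult_eq_abs[OF \<sigma>] by (simp add: e_def vec_eq_iff)
  define y where "y = (1 / 2) *\<^sub>R (\<chi> i. \<bar>p $ i\<bar>) + (1 / 2) *\<^sub>R (\<chi> i. \<bar>q $ i\<bar>)"
  have "y \<in> P"
    unfolding y_def using pq(1,2) by (intro convexD[OF P(2)]) (auto simp: unconditional_def)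
  moreover have "0 \<le> ((1 / 2) *\<^sub>R e) $ i \<and> ((1 / 2) *\<^sub>R e) $ i \<le> y $ i" for i
    using abs_triangle_ineq[of "p $ i" "q $ i"] by (simp add: e_abs y_def)
  ultimately have "(1 / 2) *\<^sub>R e \<in> P" using P(1) unfolding anti_blocking_def by blast
  then have e2P: "e \<in> (*\<^sub>R) 2 ` P" by (intro image_eqI[of _ _ "(1 / 2) *\<^sub>R e"]) simp_all
  have "e \<in> lattice_points"
    unfolding e_def using pq \<sigma>(1) by (auto intro!: sign_mult_lattice_points lattice_points_add)
  then obtain e1 e2 where edge: "edge_decomposition P \<T> e e1 e2"
    using edge_decomposition_exists[OF uni e2P] by blast
  have "({#p, q#}, {#\<sigma> * e1, \<sigma> * e2#}) \<in> separable_binomials P \<T>"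
    unfolding separable_binomials_def
    by (rule CollectI, rule exI[of _ p], rule exI[of _ q], rule exI[of _ \<sigma>], rule exI[of _ e],
        rule exI[of _ e1], rule exI[of _ e2])
      (intro conjI refl pq \<sigma>(1) e2P edge e_def[symmetric])
  then show thesis by (rule that)
qed

lemma signed_nonface_monomial_divisible:
  fixes P :: "(real^'d) set"
  assumes P: "anti_blocking P" "convex P" and uni: "unimodular_triangulation P \<T>"
    and M: "\<And>R. R \<in> monomials (P \<inter> lattice_points) \<Longrightarrow> \<not> face_monomial \<T> R \<Longrightarrow> \<exists>(A, B)\<in>M. A \<subseteq># R"
    and R: "R \<in> monomials (unconditional P \<inter> lattice_points)"
      "\<not> face_monomial (signed_triangulation \<T>) R"
  shows "\<exists>(A, B)\<in>signed_binomials M \<union> separable_binomials P \<T>. A \<subseteq># R"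
proof (cases "\<exists>p\<in>#R. \<exists>q\<in>#R. separable p q")
  case True
  then obtain p q where pq: "p \<in># R" "q \<in># R" "separable p q" by blast
  \<comment> \<open>Otherwise \<open>{#p, q#}\<close> would divide \<open>R\<close> only if
    \<open>p\<close> occurred twice.\<close>
  then have "p \<noteq> q" by (auto simp: separable_def)
  then have "{#p, q#} \<subseteq># R" using pq by (simp add: insert_subset_eq_iff in_diff_count)
  moreover obtain B where "({#p, q#}, B) \<in> separable_binomials P \<T>"
    using separable_pair_marked[OF P uni _ _ pq(3)] pq(1,2) R(1) by (auto simp: monomials_def)
  ultimately show ?thesis by blast
next
  case False
  \<comment> \<open>A closed orthant containing all points of \<open>R\<close>: if one of them is
    negative at \<open>i\<close>, then without separable pairs none is positive there.\<close>
  define \<sigma> :: "real^'d" where "\<sigma> = (\<chi> i. if \<exists>p\<in>#R. p $ i < 0 then -1 else 1)"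
  have \<sigma>: "\<sigma> \<in> sign_vectors" by (simp add: \<sigma>_def sign_vectors_def)
  have nonneg: "0 \<le> (\<sigma> * p) $ i" if "p \<in># R" for p i
  proof (cases "\<exists>q\<in>#R. q $ i < 0")
    case True
    then obtain q where q: "q \<in># R" "q $ i < 0" by blast
    then have "\<not> separable q p" using False that by blast
    with q(2) have "p $ i \<le> 0" unfolding separable_def by (metis linorder_not_le)
    with True show ?thesis by (simp add: \<sigma>_def)
  next
    case False
    then show ?thesis using that by (auto simp: \<sigma>_def not_less)
  qed
  define R' where "R' = image_mset ((*) \<sigma>) R"
  have R_eq: "R = image_mset ((*) \<sigma>) R'" by (simp add: R'_def \<sigma>)
  have "\<sigma> * p \<in> P \<inter> lattice_points" if "p \<in># R" for p
    using mem_unconditional_iff[OF \<sigma> nonneg[OF that]] R(1) that sign_mult_lattice_points[OF \<sigma>]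
    by (auto simp: monomials_def)
  then have "R' \<in> monomials (P \<inter> lattice_points)" by (auto simp: R'_def monomials_def)
  moreover have "\<not> face_monomial \<T> R'"
    using R(2) face_monomial_signed[OF \<sigma>, of \<T> R'] by (auto simp: R_eq[symmetric])
  ultimately obtain A B where AB: "(A, B) \<in> M" "A \<subseteq># R'" using M by blast
  then have "(image_mset ((*) \<sigma>) A, image_mset ((*) \<sigma>) B) \<in> signed_binomials M"
    using \<sigma> by (auto simp: signed_binomials_def)
  moreover have "image_mset ((*) \<sigma>) A \<subseteq># R"
    unfolding R_eq using AB(2) by (rule image_mset_subseteq_mono)
  ultimately show ?thesis by blast
qed

section \<open>Finiteness of both families of binomials\<close>

lemma finite_signed_binomials:
  assumes "finite M"
  shows "finite (signed_binomials M)"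
proof -
  have "signed_binomials M \<subseteq>
      (\<lambda>(\<sigma>, R, S). (image_mset ((*) \<sigma>) R, image_mset ((*) \<sigma>) S)) ` (sign_vectors \<times> M)"
    by (force simp: signed_binomials_def)
  then show ?thesis by (rule finite_subset) (simp add: finite_sign_vectors assms)
qed

lemma finite_separable_binomials:
  fixes P :: "(real^'d) set"
  assumes "finite (P \<inter> lattice_points)"
  shows "finite (separable_binomials P \<T>)"
proof -
  let ?Z = "P \<inter> lattice_points" and ?Z' = "unconditional P \<inter> lattice_points"
  have "separable_binomials P \<T> \<subseteq>
      (\<lambda>(p, q, \<sigma>, e1, e2). ({#p, q#}, {#\<sigma> * e1, \<sigma> * e2#})) ` (?Z' \<times> ?Z' \<times> sign_vectors \<times> ?Z \<times> ?Z)"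
  proof
    fix x assume "x \<in> separable_binomials P \<T>"
    then obtain p q \<sigma> e1 e2 where x: "x = ({#p, q#}, {#\<sigma> * e1, \<sigma> * e2#})"
      and "p \<in> ?Z'" "q \<in> ?Z'" "\<sigma> \<in> sign_vectors" and edge: "edge_decomposition P \<T> (\<sigma> * (p + q)) e1 e2"
      unfolding separable_binomials_def by blast
    then have "(p, q, \<sigma>, e1, e2) \<in> ?Z' \<times> ?Z' \<times> sign_vectors \<times> ?Z \<times> ?Z"
      by (simp add: edge_decomposition_def)
    then show "x \<in> (\<lambda>(p, q, \<sigma>, e1, e2). ({#p, q#}, {#\<sigma> * e1, \<sigma> * e2#})) ` (?Z' \<times> ?Z' \<times> sign_vectors \<times> ?Z \<times> ?Z)"
      by (rule image_eqI[rotated]) (simp add: x)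
  qed
  then show ?thesis
    by (rule finite_subset)
      (intro finite_imageI finite_cartesian_product finite_sign_vectors assms
        finite_unconditional_lattice_points)
qed

theorem theorem7p2:
  fixes P :: "(real^'d) set"
    and \<T> :: "(real^'d) set set"
    and r :: "(real^'d) multiset rel"
    and R S :: "nat \<Rightarrow> (real^'d) multiset"
    and m :: nat
  assumes "lattice_polytope P"
    and "anti_blocking P"
    and "unimodular_triangulation P \<T>"
    and "regular_triangulation P \<T>"
    and "induced_term_order P \<T> r"
    and "reduced_groebner_basis (P \<inter> lattice_points) r (toric_ideal P) (binomials {(R i, S i) | i. i < m})"
    and "correctly_marked r {(R i, S i) | i. i < m}"
  shows "unimodular_triangulation (unconditional P) (signed_triangulation \<T>) \<and>
         regular_triangulation (unconditional P) (signed_triangulation \<T>) \<and>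
         (\<forall>r'. induced_term_order (unconditional P) (signed_triangulation \<T>) r' \<longrightarrow>
            groebner_basis (unconditional P \<inter> lattice_points) r' (toric_ideal (unconditional P))
              (binomials (signed_binomials {(R i, S i) | i. i < m} \<union> separable_binomials P \<T>)) \<and>
            correctly_marked r' (signed_binomials {(R i, S i) | i. i < m} \<union> separable_binomials P \<T>))"
proof -
  let ?Z = "P \<inter> lattice_points" and ?Z' = "unconditional P \<inter> lattice_points"
  define M where "M = {(R i, S i) | i. i < m}"
  define M' where "M' = signed_binomials M \<union> separable_binomials P \<T>"
  note P = assms(2) and uni = assms(3) and r = assms(5)
  note G = assms(6)[folded M_def] and marked = assms(7)[folded M_def]
  have "convex P" and "bounded P"
    using assms(1) by (auto simp: lattice_polytope_def finite_imp_bounded bounded_convex_hull)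
  have fin: "finite ?Z" by (rule finite_lattice_points_bounded[OF \<open>bounded P\<close>])
  have fin': "finite ?Z'" by (rule finite_unconditional_lattice_points[OF fin])
  have uni': "unimodular_triangulation (unconditional P) (signed_triangulation \<T>)"
    by (rule unimodular_triangulation_signed[OF P uni])
  have "finite M" by (simp add: M_def)
  then have "finite M'"
    by (simp add: M'_def finite_signed_binomials finite_separable_binomials[OF fin])
  note M = reduced_groebner_basis_binomial[OF \<open>convex P\<close> r uni fin G marked]
  have M': "A \<in> monomials ?Z' \<and> B \<in> monomials ?Z' \<and> same_fiber A B \<and> A \<noteq> B \<and>
      face_monomial (signed_triangulation \<T>) B" if "(A, B) \<in> M'" for A B
    using that signed_binomials_properties[OF P, of M \<T> A B] M separable_binomials_properties[OF P, of A B \<T>]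
    by (auto simp: M'_def)
  \<comment> \<open>Together with the fact \<open>M'\<close> above, this is what is carried from the
    order \<open>r\<close> to the orders \<open>r'\<close>; neither statement mentions an
    order.\<close>
  have dvd: "\<exists>(A, B)\<in>M. A \<subseteq># Q" if Q: "Q \<in> monomials ?Z" "\<not> face_monomial \<T> Q" for Q
  proof -
    have "groebner_basis ?Z r (toric_ideal P) (binomials M)"
      using G by (simp add: reduced_groebner_basis_def)
    then obtain g A where g: "g \<in> binomials M" "is_leading_monomial r g A" "A \<subseteq># Q"
      using nonface_monomial_divisible[OF \<open>convex P\<close> r uni fin _ Q] by blast
    have "term_order ?Z r" using r by (simp add: induced_term_order_def)
    then obtain B where "(A, B) \<in> M"
      using correctly_marked_unique[OF _ marked g(1,2)] by blast
    then show ?thesis using g(3) by blast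
  qed
  have "groebner_basis ?Z' r' (toric_ideal (unconditional P)) (binomials M') \<and> correctly_marked r' M'"
    if r': "induced_term_order (unconditional P) (signed_triangulation \<T>) r'" for r'
  proof
    have lead: "is_leading_monomial r' (mon A - mon B) A" if "(A, B) \<in> M'" for A B
      using M'[OF that] by (intro binomial_leading_monomial[OF r' uni' fin']) auto
    then show "correctly_marked r' M'" by (auto simp: correctly_marked_def)
    have ord: "term_order ?Z' r'" using r' by (simp add: induced_term_order_def)
    show "groebner_basis ?Z' r' (toric_ideal (unconditional P)) (binomials M')"
    proof (rule groebner_basisI[OF ord])
      show "finite (binomials M')" using \<open>finite M'\<close> by (simp add: binomials_def)
      show "binomials M' \<subseteq> toric_ideal (unconditional P)"
        using M' by (auto simp: binomials_def intro: binomial_in_toric_ideal)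
    next
      fix f Q assume f: "f \<in> toric_ideal (unconditional P)" "is_leading_monomial r' f Q"
      have "Q \<in> monomials ?Z'"
        using is_leading_monomial_in_monomials[OF ord f(2)] f(2) by (simp add: is_leading_monomial_def)
      moreover have "\<not> face_monomial (signed_triangulation \<T>) Q"
        by (rule face_monomial_not_leading[OF r' uni' fin' f])
      ultimately obtain A B where AB: "(A, B) \<in> M'" "A \<subseteq># Q"
        using signed_nonface_monomial_divisible[OF P \<open>convex P\<close> uni dvd, of Q] unfolding M'_def by blast
      have "mon A - mon B \<in> binomials M'" using AB(1) by (force simp: binomials_def)
      then show "\<exists>g\<in>binomials M'. \<exists>A. is_leading_monomial r' g A \<and> A \<subseteq># Q"
        using lead[OF AB(1)] AB(2) by blast
    qed
  qed
  then show ?thesis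
    using uni' regular_triangulation_signed[OF P fin uni assms(4)] unfolding M'_def M_def by blast
qed

end
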